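(* Let $\lambda\in\mathfrak h^*$ be a generic weight and $\mu,\mu'\in(\mathbb C^* )^r$. The modified Whittaker function $\widetilde W_\lambda^{\mu,\mu'}(\phi)=e^{\sum_{i=1}^r\phi_i}\,W_\lambda^{\mu,\mu'}(\phi)$ satisfies the Toda differential equation associated with the root system of $\mathfrak g$: $$H\,\widetilde W_\lambda^{\mu,\mu'}(\phi)=E_\lambda\,\widetilde W_\lambda^{\mu,\mu'}(\phi),$$ where $$H=\frac12\,(\nabla_\phi|\nabla_\phi)+\sum_{j=1}^r\nu_j\,e^{-(\alpha_j|\phi)},\qquad E_\lambda=\frac12\,(\lambda+\rho|\lambda+\rho),\qquad \nu_j=d_j\mu_j\mu_j' .$$
   Context: Lie algebra data. $\mathfrak g=\mathfrak n_-\oplus\mathfrak h\oplus\mathfrak n_+$ is a finite-dimensional simple complex Lie algebra of rank $r$ with simple roots $\alpha_1,\dots,\alpha_r$, Cartan matrix $C$, and Chevalley generators $e_i\in\mathfrak n_+$, $f_i\in\mathfrak n_-$, $h_i\in\mathfrak h$ satisfying $[h_i,h_j]=0$, $[h_i,e_j]=C_{j,i}e_j$, $[h_i,f_j]=-C_{j,i}f_j$, $[e_i,f_j]=\delta_{i,j}h_j$ and the Serre relations. The $d_i$ are the coprime positive integers with $C_{i,j}d_j=C_{j,i}d_i$. The co-roots $\alpha_i^\vee\in\mathfrak h^*$ are defined by $\alpha_i=d_i\alpha_i^\vee$, and $(\cdot|\cdot)$ is the symmetric bilinear form on $\mathfrak h^*$ with $(\alpha_i|\alpha_j^\vee)=C_{i,j}$.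 One has $h_j(\lambda)=(\lambda|\alpha_j^\vee)$ for $\lambda\in\mathfrak h^*$; $(\omega_i|\alpha_j^\vee)=\delta_{i,j}$; $\rho=\sum_{i=1}^r\omega_i$; $Q_+=\bigoplus_{i=1}^r\mathbb Z_{\ge0}\alpha_i$. Variables. $\phi=\sum_{i=1}^r\phi_i\alpha_i^\vee$ with formal variables $\phi_i$, so that $(\alpha_j|\phi)=\sum_kC_{j,k}\phi_k$; $\nabla_\phi=\sum_{i=1}^r\frac{\partial}{\partial\phi_i}\omega_i$, so that $(\nabla_\phi|\nabla_\phi)=\sum_{i,j}(\omega_i|\omega_j)\frac{\partial^2}{\partial\phi_i\partial\phi_j}$. Verma module and Whittaker function. $V_\lambda=U(\mathfrak n_-)|\lambda\rangle$ is the (irreducible) Verma module with highest weight vector $|\lambda\rangle$; its completion is the product $\prod_{\beta\in Q_+}V[\lambda-\beta]$ of its weight spaces. The dual right module is $V_\lambda^*=\langle\lambda|U(\mathfrak n_+)$ with $\langle\lambda|\mathfrak n_-=0$, $\langle\lambda|h=h(\lambda)\langle\lambda|$, $\langle\lambda|\lambda\rangle=1$, similarly completed, with pairing $(\langle\lambda|a)(b|\lambda\rangle)=\langle\lambda|ab|\lambda\rangle$. $|w\rangle_\lambda^\mu$ is the unique element of the completion of $V_\lambda$ with $\langle\lambda|w\rangle=1$ and $e_i|w\rangle=\mu_i|w\rangle$ for all $i$; ${}^{\mu'}_\lambda\langle w|$ is the unique element of the completion of $V_\lambda^*$ with $\langle w|\lambda\rangle=1$ and $\langle w|f_i=\mu_i'\langle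 w|$ for all $i$. The Whittaker function is $W_\lambda^{\mu,\mu'}(\phi)={}^{\mu'}_\lambda\langle w|e^{\sum_i\phi_ih_i}|w\rangle^\mu_\lambda$, a formal series (the sum over $\beta\in Q_+$ of the pairings of the components of weight $\lambda-\beta$, on which $e^{\sum_i\phi_ih_i}$ acts by $e^{(\lambda-\beta|\phi)}$). The differential equation is an identity of formal series. Genericity. "$\lambda$ generic" means that $V_\lambda$ is irreducible and $(\lambda+\rho|\beta)-\frac12(\beta|\beta)\neq0$ for all $\beta\in Q_+\setminus\{0\}$. *)

theory Defs
  imports "HOL-Analysis.Cartesian_Space" "HOL-Library.Poly_Mapping"
begin

section \<open>Lie algebras\<close>

locale lie_algebra = vector_space scale
  for scale :: "complex \<Rightarrow> 'g::ab_group_add \<Rightarrow> 'g" +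
  fixes bracket :: "'g \<Rightarrow> 'g \<Rightarrow> 'g"
  assumes bracket_add_left: "bracket (x + y) z = bracket x z + bracket y z"
    and bracket_add_right: "bracket x (y + z) = bracket x y + bracket x z"
    and bracket_scale_left: "bracket (scale c x) y = scale c (bracket x y)"
    and bracket_scale_right: "bracket x (scale c y) = scale c (bracket x y)"
    and bracket_self: "bracket x x = 0"
    and jacobi: "bracket x (bracket y z) + bracket y (bracket z x) + bracket z (bracket x y) = 0"
begin

definition subalgebra :: "'g set \<Rightarrow> bool" where
  "subalgebra S \<longleftrightarrow> subspace S \<and> (\<forall>x\<in>S. \<forall>y\<in>S. bracket x y \<in> S)"

definition lie_ideal :: "'g set \<Rightarrow> bool" where
  "lie_ideal S \<longleftrightarrow> subspace S \<and> (\<forall>x. \<forall>y\<in>S. bracket x y \<in> S)"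

definition simple_algebra :: bool where
  "simple_algebra \<longleftrightarrow>
     (\<exists>x y. bracket x y \<noteq> 0) \<and> (\<forall>S. lie_ideal S \<longrightarrow> S = {0} \<or> S = UNIV)"

end

text \<open>
  The simple roots are indexed by a finite type \<open>'i\<close>, whose cardinality is the rank.

  A weight \<open>lam\<close>, i.e. a linear form on the Cartan subalgebra, is represented by its values
  on the basis \<open>h\<^sub>i\<close>: \<open>lam $ i = h\<^sub>i(lam)\<close>. These are its coordinates with respect to the
  fundamental weights \<open>\<omega>\<^sub>i\<close>.
\<close>

record ('g, 'i) chevalley_data =
  scale :: "complex \<Rightarrow> 'g \<Rightarrow> 'g"
  bracket :: "'g \<Rightarrow> 'g \<Rightarrow> 'g"
  chev_e :: "'i \<Rightarrow> 'g"
  chev_f :: "'i \<Rightarrow> 'g"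
  chev_h :: "'i \<Rightarrow> 'g"
  cartan :: "'i \<Rightarrow> 'i \<Rightarrow> int"
  symmetrizer :: "'i \<Rightarrow> nat"
  form :: "complex ^ 'i \<Rightarrow> complex ^ 'i \<Rightarrow> complex"

definition nilp_pos :: "('g::ab_group_add, 'i::finite) chevalley_data \<Rightarrow> 'g set" where
  "nilp_pos L = lie_algebra.subalgebra (scale L) (bracket L) hull range (chev_e L)"

definition nilp_neg :: "('g::ab_group_add, 'i::finite) chevalley_data \<Rightarrow> 'g set" where
  "nilp_neg L = lie_algebra.subalgebra (scale L) (bracket L) hull range (chev_f L)"

definition cartan_subalgebra :: "('g::ab_group_add, 'i::finite) chevalley_data \<Rightarrow> 'g set" where
  "cartan_subalgebra L = module.span (scale L) (range (chev_h L))"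

text \<open>Since \<open>[h\<^sub>i, e\<^sub>j] = C\<^sub>j\<^sub>i e\<^sub>j\<close>, row \<open>j\<close> of the Cartan matrix lists the values \<open>\<alpha>\<^sub>j(h\<^sub>i)\<close>.\<close>

definition simple_root :: "('g, 'i::finite) chevalley_data \<Rightarrow> 'i \<Rightarrow> complex ^ 'i" where
  "simple_root L j = (\<chi> i. of_int (cartan L j i))"

definition simple_coroot :: "('g, 'i::finite) chevalley_data \<Rightarrow> 'i \<Rightarrow> complex ^ 'i" where
  "simple_coroot L j = (1 / of_nat (symmetrizer L j)) *s simple_root L j"

definition fund_weight :: "'i::finite \<Rightarrow> complex ^ 'i" where
  "fund_weight i = axis i 1"

definition weyl_vector :: "complex ^ 'i::finite" where
  "weyl_vector = (\<Sum>i\<in>UNIV. fund_weight i)"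

locale simple_lie_algebra = lie_algebra "scale L" "bracket L"
  for L :: "('g::ab_group_add, 'i::finite) chevalley_data" +
  assumes finite_dimensional: "\<exists>B. finite B \<and> span B = UNIV"
    and simple: simple_algebra
    and cartan_diag: "cartan L i i = 2"
    and cartan_offdiag: "i \<noteq> j \<Longrightarrow> cartan L i j \<le> 0"
    and cartan_zero: "cartan L i j = 0 \<longleftrightarrow> cartan L j i = 0"
    and symmetrizer_pos: "symmetrizer L i > 0"
    and symmetrizer_coprime: "Gcd (range (symmetrizer L)) = 1"
    and symmetrizer_cartan:
      "cartan L i j * int (symmetrizer L j) = cartan L j i * int (symmetrizer L i)"
    and bracket_h_h: "bracket L (chev_h L i) (chev_h L j) = 0"
    and bracket_h_e:
      "bracket L (chev_h L i) (chev_e L j) = scale L (of_int (cartan L j i)) (chev_e L j)"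
    and bracket_h_f:
      "bracket L (chev_h L i) (chev_f L j) = scale L (- of_int (cartan L j i)) (chev_f L j)"
    and bracket_e_f:
      "bracket L (chev_e L i) (chev_f L j) = (if i = j then chev_h L j else 0)"
    and serre_e:
      "i \<noteq> j \<Longrightarrow> (bracket L (chev_e L i) ^^ nat (1 - cartan L j i)) (chev_e L j) = 0"
    and serre_f:
      "i \<noteq> j \<Longrightarrow> (bracket L (chev_f L i) ^^ nat (1 - cartan L j i)) (chev_f L j) = 0"
    and h_inj: "inj (chev_h L)"
    and h_independent: "independent (range (chev_h L))"
    and triangular: "\<exists>!(y, z, x). y \<in> nilp_neg L \<and> z \<in> cartan_subalgebra L \<and> x \<in> nilp_pos L
      \<and> v = y + z + x"
    and form_linear: "Vector_Spaces.linear (*s) (*) (form L \<kappa>)"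
    and form_sym: "form L \<kappa> \<kappa>' = form L \<kappa>' \<kappa>"
    and form_root_coroot:
      "form L (simple_root L i) (simple_coroot L j) = of_int (cartan L i j)"

text \<open>Elements of \<open>Q\<^sub>+\<close> are given by their multiplicities \<open>n\<close> with respect to the simple roots.\<close>

definition root_comb ::
    "('g, 'i::finite) chevalley_data \<Rightarrow> ('i \<Rightarrow> nat) \<Rightarrow> complex ^ 'i" where
  "root_comb L n = (\<Sum>i\<in>UNIV. of_nat (n i) *s simple_root L i)"

definition incr :: "'i \<Rightarrow> ('i \<Rightarrow> nat) \<Rightarrow> 'i \<Rightarrow> nat" where
  "incr i n = n(i := Suc (n i))"

section \<open>The universal enveloping algebra\<close>

text \<open>
  The free associative algebra on the set \<open>'g\<close> is the monoid algebra of the free monoid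
  on \<open>'g\<close>. The latter is written additively because this is what the convolution
  product on polynomial mappings expects.
\<close>

datatype 'a free_monoid = Word "'a list"

instantiation free_monoid :: (type) monoid_add
begin

definition zero_free_monoid :: "'a free_monoid" where
  "0 = Word []"

fun plus_free_monoid :: "'a free_monoid \<Rightarrow> 'a free_monoid \<Rightarrow> 'a free_monoid" where
  "Word xs + Word ys = Word (xs @ ys)"

instance
proof
  fix a b c :: "'a free_monoid"
  show "a + b + c = a + (b + c)" by (cases a; cases b; cases c) simp
  show "0 + a = a" by (cases a) (simp add: zero_free_monoid_def)
  show "a + 0 = a" by (cases a) (simp add: zero_free_monoid_def)
qed

end

type_synonym 'g free_algebra = "'g free_monoid \<Rightarrow>\<^sub>0 complex"

definition gen :: "'g \<Rightarrow> 'g free_algebra" where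
  "gen x = Poly_Mapping.single (Word [x]) 1"

definition const :: "complex \<Rightarrow> 'g free_algebra" where
  "const c = Poly_Mapping.single 0 c"

definition left_ideal :: "'a::ring_1 set \<Rightarrow> bool" where
  "left_ideal J \<longleftrightarrow> 0 \<in> J \<and> (\<forall>x\<in>J. \<forall>y\<in>J. x + y \<in> J) \<and> (\<forall>a. \<forall>x\<in>J. a * x \<in> J)"

definition right_ideal :: "'a::ring_1 set \<Rightarrow> bool" where
  "right_ideal J \<longleftrightarrow> 0 \<in> J \<and> (\<forall>x\<in>J. \<forall>y\<in>J. x + y \<in> J) \<and> (\<forall>a. \<forall>x\<in>J. x * a \<in> J)"

definition two_sided_ideal :: "'a::ring_1 set \<Rightarrow> bool" where
  "two_sided_ideal J \<longleftrightarrow> left_ideal J \<and> right_ideal J"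

text \<open>\<open>U(g)\<close> is the quotient of the free algebra by the following two-sided ideal.\<close>

definition enveloping_ideal ::
    "('g::ab_group_add, 'i::finite) chevalley_data \<Rightarrow> 'g free_algebra set" where
  "enveloping_ideal L = two_sided_ideal hull
     ({gen (x + y) - gen x - gen y |x y. True}
      \<union> {gen (scale L c x) - const c * gen x |c x. True}
      \<union> {gen x * gen y - gen y * gen x - gen (bracket L x y) |x y. True})"

section \<open>Verma modules\<close>

text \<open>
  The Verma module is \<open>V\<^sub>\<lambda> = U(g) / (U(g) n\<^sub>+ + \<Sum> U(g) (h - h(\<lambda>)))\<close> and the dual right module is
  \<open>V\<^sub>\<lambda>\<^sup>* = U(g) / (n\<^sub>- U(g) + \<Sum> (h - h(\<lambda>)) U(g))\<close>. Both are realised as quotients of the free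
  algebra; the ideals below are the preimages of the displayed ones. Vectors are cosets,
  and the class of \<open>1\<close> is the highest weight vector \<open>|\<lambda>\<rangle>\<close>, respectively \<open>\<langle>\<lambda>|\<close>.
\<close>

definition verma_ideal ::
    "('g::ab_group_add, 'i::finite) chevalley_data \<Rightarrow> complex ^ 'i \<Rightarrow> 'g free_algebra set" where
  "verma_ideal L lam = left_ideal hull
     (enveloping_ideal L \<union> gen ` nilp_pos L \<union> range (\<lambda>i. gen (chev_h L i) - const (lam $ i)))"

definition dual_verma_ideal ::
    "('g::ab_group_add, 'i::finite) chevalley_data \<Rightarrow> complex ^ 'i \<Rightarrow> 'g free_algebra set" where
  "dual_verma_ideal L lam = right_ideal hull
     (enveloping_ideal L \<union> gen ` nilp_neg L \<union> range (\<lambda>i. gen (chev_h L i) - const (lam $ i)))"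

definition cong_mod :: "'a::ring_1 set \<Rightarrow> ('a \<times> 'a) set" where
  "cong_mod J = {(a, b). a - b \<in> J}"

definition coset :: "'a::ring_1 set \<Rightarrow> 'a \<Rightarrow> 'a set" where
  "coset J a = cong_mod J `` {a}"

definition coset_add :: "'a::ring_1 set \<Rightarrow> 'a set \<Rightarrow> 'a set \<Rightarrow> 'a set" where
  "coset_add J S T = (\<Union>s\<in>S. \<Union>t\<in>T. coset J (s + t))"

definition left_act :: "'a::ring_1 set \<Rightarrow> 'a \<Rightarrow> 'a set \<Rightarrow> 'a set" where
  "left_act J a S = (\<Union>s\<in>S. coset J (a * s))"

definition right_act :: "'a::ring_1 set \<Rightarrow> 'a set \<Rightarrow> 'a \<Rightarrow> 'a set" where
  "right_act J S a = (\<Union>s\<in>S. coset J (s * a))"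

definition verma ::
    "('g::ab_group_add, 'i::finite) chevalley_data \<Rightarrow> complex ^ 'i \<Rightarrow> 'g free_algebra set set" where
  "verma L lam = UNIV // cong_mod (verma_ideal L lam)"

definition dual_verma ::
    "('g::ab_group_add, 'i::finite) chevalley_data \<Rightarrow> complex ^ 'i \<Rightarrow> 'g free_algebra set set" where
  "dual_verma L lam = UNIV // cong_mod (dual_verma_ideal L lam)"

definition verma_submodule ::
    "('g::ab_group_add, 'i::finite) chevalley_data \<Rightarrow> complex ^ 'i \<Rightarrow>
     'g free_algebra set set \<Rightarrow> bool" where
  "verma_submodule L lam N \<longleftrightarrow> N \<subseteq> verma L lam \<and> coset (verma_ideal L lam) 0 \<in> N
     \<and> (\<forall>S\<in>N. \<forall>T\<in>N. coset_add (verma_ideal L lam) S T \<in> N)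
     \<and> (\<forall>a. \<forall>S\<in>N. left_act (verma_ideal L lam) a S \<in> N)"

definition verma_irreducible ::
    "('g::ab_group_add, 'i::finite) chevalley_data \<Rightarrow> complex ^ 'i \<Rightarrow> bool" where
  "verma_irreducible L lam \<longleftrightarrow> verma L lam \<noteq> {coset (verma_ideal L lam) 0}
     \<and> (\<forall>N. verma_submodule L lam N \<longrightarrow> N = {coset (verma_ideal L lam) 0} \<or> N = verma L lam)"

definition verma_weight_space ::
    "('g::ab_group_add, 'i::finite) chevalley_data \<Rightarrow> complex ^ 'i \<Rightarrow> complex ^ 'i \<Rightarrow>
     'g free_algebra set set" where
  "verma_weight_space L lam \<kappa> = {S \<in> verma L lam. \<forall>i.
     left_act (verma_ideal L lam) (gen (chev_h L i)) S
       = left_act (verma_ideal L lam) (const (\<kappa> $ i)) S}"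

definition dual_verma_weight_space ::
    "('g::ab_group_add, 'i::finite) chevalley_data \<Rightarrow> complex ^ 'i \<Rightarrow> complex ^ 'i \<Rightarrow>
     'g free_algebra set set" where
  "dual_verma_weight_space L lam \<kappa> = {S \<in> dual_verma L lam. \<forall>i.
     right_act (dual_verma_ideal L lam) S (gen (chev_h L i))
       = right_act (dual_verma_ideal L lam) S (const (\<kappa> $ i))}"

text \<open>
  \<open>\<langle>\<lambda>|x|\<lambda>\<rangle>\<close> is the scalar by which \<open>x\<close> acts between \<open>\<langle>\<lambda>|\<close> and \<open>|\<lambda>\<rangle>\<close>: the relations on the right
  (highest weight vector) and on the left (dual vector) reduce \<open>x\<close> to this scalar,
  and \<open>\<langle>\<lambda>|\<lambda>\<rangle> = 1\<close>.
\<close>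

definition vev ::
    "('g::ab_group_add, 'i::finite) chevalley_data \<Rightarrow> complex ^ 'i \<Rightarrow> 'g free_algebra \<Rightarrow> complex"
  where
  "vev L lam x =
     (THE c. \<exists>l\<in>verma_ideal L lam. \<exists>r\<in>dual_verma_ideal L lam. x = const c + l + r)"

text \<open>The pairing \<open>(\<langle>\<lambda>|a)(b|\<lambda>\<rangle>) = \<langle>\<lambda>|ab|\<lambda>\<rangle>\<close> does not depend on the representatives.\<close>

definition pairing ::
    "('g::ab_group_add, 'i::finite) chevalley_data \<Rightarrow> complex ^ 'i \<Rightarrow>
     'g free_algebra set \<Rightarrow> 'g free_algebra set \<Rightarrow> complex" where
  "pairing L lam S T = the_elem ((\<lambda>(a, b). vev L lam (a * b)) ` (S \<times> T))"

definition generic ::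
    "('g::ab_group_add, 'i::finite) chevalley_data \<Rightarrow> complex ^ 'i \<Rightarrow> bool" where
  "generic L lam \<longleftrightarrow> verma_irreducible L lam
     \<and> (\<forall>n. n \<noteq> (\<lambda>_. 0) \<longrightarrow>
          form L (lam + weyl_vector) (root_comb L n)
            - 1/2 * form L (root_comb L n) (root_comb L n) \<noteq> 0)"

section \<open>Whittaker vectors\<close>

text \<open>
  Elements of the completions are families of weight vectors indexed by \<open>Q\<^sub>+\<close>, the
  component at \<open>n\<close> having weight \<open>lam - root_comb L n\<close>.
\<close>

definition verma_completion ::
    "('g::ab_group_add, 'i::finite) chevalley_data \<Rightarrow> complex ^ 'i \<Rightarrow>
     (('i \<Rightarrow> nat) \<Rightarrow> 'g free_algebra set) set" where
  "verma_completion L lam = {w. \<forall>n. w n \<in> verma_weight_space L lam (lam - root_comb L n)}"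

definition dual_verma_completion ::
    "('g::ab_group_add, 'i::finite) chevalley_data \<Rightarrow> complex ^ 'i \<Rightarrow>
     (('i \<Rightarrow> nat) \<Rightarrow> 'g free_algebra set) set" where
  "dual_verma_completion L lam = {w. \<forall>n. w n \<in> dual_verma_weight_space L lam (lam - root_comb L n)}"

text \<open>
  The left action of \<open>e\<^sub>i\<close> and the right action of \<open>f\<^sub>i\<close> both map the weight space of
  weight \<open>\<kappa>\<close> to that of weight \<open>\<kappa> + \<alpha>\<^sub>i\<close>. Hence the component at \<open>n\<close> of the image comes
  from the component at \<open>incr i n\<close>.
\<close>

definition whittaker_vectors ::
    "('g::ab_group_add, 'i::finite) chevalley_data \<Rightarrow> complex ^ 'i \<Rightarrow> ('i \<Rightarrow> complex) \<Rightarrow>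
     (('i \<Rightarrow> nat) \<Rightarrow> 'g free_algebra set) set" where
  "whittaker_vectors L lam \<mu> = {w \<in> verma_completion L lam.
     pairing L lam (coset (dual_verma_ideal L lam) 1) (w (\<lambda>_. 0)) = 1
     \<and> (\<forall>i n. left_act (verma_ideal L lam) (gen (chev_e L i)) (w (incr i n))
              = left_act (verma_ideal L lam) (const (\<mu> i)) (w n))}"

definition dual_whittaker_vectors ::
    "('g::ab_group_add, 'i::finite) chevalley_data \<Rightarrow> complex ^ 'i \<Rightarrow> ('i \<Rightarrow> complex) \<Rightarrow>
     (('i \<Rightarrow> nat) \<Rightarrow> 'g free_algebra set) set" where
  "dual_whittaker_vectors L lam \<mu>' = {w \<in> dual_verma_completion L lam.
     pairing L lam (w (\<lambda>_. 0)) (coset (verma_ideal L lam) 1) = 1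
     \<and> (\<forall>i n. right_act (dual_verma_ideal L lam) (w (incr i n)) (gen (chev_f L i))
              = right_act (dual_verma_ideal L lam) (w n) (const (\<mu>' i)))}"

text \<open>For generic \<open>\<lambda>\<close> the Whittaker vectors are unique, so the choice is no choice.\<close>

definition whittaker_vector ::
    "('g::ab_group_add, 'i::finite) chevalley_data \<Rightarrow> complex ^ 'i \<Rightarrow> ('i \<Rightarrow> complex) \<Rightarrow>
     ('i \<Rightarrow> nat) \<Rightarrow> 'g free_algebra set" where
  "whittaker_vector L lam \<mu> = (SOME w. w \<in> whittaker_vectors L lam \<mu>)"

definition dual_whittaker_vector ::
    "('g::ab_group_add, 'i::finite) chevalley_data \<Rightarrow> complex ^ 'i \<Rightarrow> ('i \<Rightarrow> complex) \<Rightarrow>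
     ('i \<Rightarrow> nat) \<Rightarrow> 'g free_algebra set" where
  "dual_whittaker_vector L lam \<mu>' = (SOME w. w \<in> dual_whittaker_vectors L lam \<mu>')"

section \<open>Formal exponential series and the Toda operator\<close>

text \<open>
  A formal series \<open>\<Sum>\<^sub>\<kappa> F(\<kappa>) e\<^bsup>(\<kappa>|\<phi>)\<^esup>\<close> is given by its coefficient function \<open>F\<close>. As
  \<open>\<phi> = \<Sum> \<phi>\<^sub>i \<alpha>\<^sub>i\<^sup>\<or>\<close>, we have \<open>(\<kappa>|\<phi>) = \<Sum> \<phi>\<^sub>i (\<kappa> $ i)\<close>; so \<open>\<partial>/\<partial>\<phi>\<^sub>i\<close> multiplies the coefficient
  at \<open>\<kappa>\<close> by \<open>\<kappa> $ i\<close>.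
\<close>

type_synonym 'i formal_series = "complex ^ 'i \<Rightarrow> complex"

definition exp_mult :: "complex ^ 'i \<Rightarrow> 'i::finite formal_series \<Rightarrow> 'i formal_series" where
  "exp_mult \<kappa> F = (\<lambda>\<eta>. F (\<eta> - \<kappa>))"

definition partial :: "'i::finite \<Rightarrow> 'i formal_series \<Rightarrow> 'i formal_series" where
  "partial i F = (\<lambda>\<eta>. \<eta> $ i * F \<eta>)"

text \<open>
  \<open>W = \<Sum>\<^bsub>\<beta> \<in> Q\<^sub>+\<^esub> \<langle>w'\<^sub>\<beta>|w\<^sub>\<beta>\<rangle> e\<^bsup>(\<lambda>-\<beta>|\<phi>)\<^esup>\<close>. The sum below has at most one term, since the
  simple roots are linearly independent.
\<close>

definition whittaker_function ::
    "('g::ab_group_add, 'i::finite) chevalley_data \<Rightarrow> complex ^ 'i \<Rightarrow>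
     ('i \<Rightarrow> complex) \<Rightarrow> ('i \<Rightarrow> complex) \<Rightarrow> 'i formal_series" where
  "whittaker_function L lam \<mu> \<mu>' = (\<lambda>\<eta>. \<Sum>n | lam - root_comb L n = \<eta>.
     pairing L lam (dual_whittaker_vector L lam \<mu>' n) (whittaker_vector L lam \<mu> n))"

definition modified_whittaker_function ::
    "('g::ab_group_add, 'i::finite) chevalley_data \<Rightarrow> complex ^ 'i \<Rightarrow>
     ('i \<Rightarrow> complex) \<Rightarrow> ('i \<Rightarrow> complex) \<Rightarrow> 'i formal_series" where
  "modified_whittaker_function L lam \<mu> \<mu>' = exp_mult (\<chi> i. 1) (whittaker_function L lam \<mu> \<mu>')"

definition toda_hamiltonian ::
    "('g, 'i::finite) chevalley_data \<Rightarrow> ('i \<Rightarrow> complex) \<Rightarrow> 'i formal_series \<Rightarrow> 'i formal_series"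
  where
  "toda_hamiltonian L \<nu> F = (\<lambda>\<eta>.
     1/2 * (\<Sum>i\<in>UNIV. \<Sum>j\<in>UNIV.
        form L (fund_weight i) (fund_weight j) * partial i (partial j F) \<eta>)
     + (\<Sum>j\<in>UNIV. \<nu> j * exp_mult (- simple_root L j) F \<eta>))"

end

(*
  Write c_n = (lam + rho | beta) - (beta | beta)/2 for beta = sum n_i alpha_i. The recursion
    c_n w_n = sum_i d_i mu_i f_i w_(n - e_i),   w_0 = |lam>,
  is what the Casimir element forces on a Whittaker vector, and it is solvable because c_n does
  not vanish for n != 0. That its solution is a Whittaker vector needs neither the Casimir
  element nor the PBW theorem: by induction,
    c_n e_j w_n = mu_j (c_(n - e_j) + d_j h_j(lam - beta + alpha_j)) w_(n - e_j),
  and the bracket equals c_n. The argument only uses the commutation relations, hence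
  it applies to the dual right module as well. A difference of two Whittaker vectors is singular
  in its lowest nonzero degree, so it vanishes when the Verma module is irreducible. Pairing the
  recursion with the dual Whittaker vector gives
    c_n W_n = sum_i d_i mu_i mu'_i W_(n - e_i)
  for the coefficients of the Whittaker function. This is the Toda equation, since
  (lam + rho - beta | lam + rho - beta)/2 = (lam + rho | lam + rho)/2 - c_n.
*)
theory Submission
  imports Defs
begin

text \<open>The obstacle is that \<open>vev\<close>, \<open>pairing\<close> and the Whittaker
  vectors are given by \<open>THE\<close>, \<open>the_elem\<close> and \<open>SOME\<close> on
  quotients of a free algebra for which no basis is at hand, so each has to be shown meaningful.
  Weights replace the basis. The h_i commute modulo the ideals, hence a vector of weight \<kappa>
  that is also a sum of vectors of other weights vanishes in the quotient. Distinct elements of Q_+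
  give distinct weights because the simple roots are linearly independent; this comes from
  simplicity, since a kernel vector of the Cartan matrix would yield a nonzero central element.
  Finally, 1 is not in the Verma ideal because an irreducible module is nonzero. Together these
  facts make <lam|x|lam> a well-defined number, force a vector of weight lam with zero expectation
  value to vanish, and prevent a singular vector of lower weight from generating the highest weight
  vector.\<close>

definition decr :: "'i \<Rightarrow> ('i \<Rightarrow> nat) \<Rightarrow> 'i \<Rightarrow> nat" where
  "decr i n = n(i := n i - 1)"

lemma incr_decr: "n i \<noteq> 0 \<Longrightarrow> incr i (decr i n) = n"
  by (auto simp: incr_def decr_def)

lemma decr_incr [simp]: "decr i (incr i n) = n"
  by (auto simp: incr_def decr_def)

lemma incr_neq_0 [simp]: "incr i n i \<noteq> 0" "incr i n \<noteq> (\<lambda>_. 0)"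
  by (auto simp: incr_def fun_eq_iff)

lemma sum_decr_less: "n i \<noteq> 0 \<Longrightarrow> sum (decr i n) UNIV < sum n (UNIV :: 'i::finite set)"
  by (rule sum_strict_mono_ex1) (auto simp: decr_def)

section \<open>Highest weight vectors modulo a subspace\<close>

text \<open>Working modulo \<open>J\<close> keeps all computations on representatives, so the
  quotient modules need no type of their own. The operators are abstract because there are two
  instances: the Verma module, and the dual right module, in which right multiplication by f_i plays
  the role of \<open>E i\<close>.\<close>

locale highest_weight_module = vector_space sc
  for sc :: "complex \<Rightarrow> 'v::ab_group_add \<Rightarrow> 'v" +
  fixes J :: "'v set"
    and E F H :: "'i::finite \<Rightarrow> 'v \<Rightarrow> 'v"
    and alpha :: "'i \<Rightarrow> complex ^ 'i"
    and lam :: "complex ^ 'i"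
    and v0 :: 'v
  assumes J_subspace: "subspace J"
    and E_add: "E i (x + y) = E i x + E i y" and E_scale: "E i (sc c x) = sc c (E i x)"
    and F_add: "F i (x + y) = F i x + F i y" and F_scale: "F i (sc c x) = sc c (F i x)"
    and H_add: "H i (x + y) = H i x + H i y" and H_scale: "H i (sc c x) = sc c (H i x)"
    and E_J: "x \<in> J \<Longrightarrow> E i x \<in> J"
    and F_J: "x \<in> J \<Longrightarrow> F i x \<in> J"
    and H_J: "x \<in> J \<Longrightarrow> H i x \<in> J"
    and comm_HH: "H i (H j x) - H j (H i x) \<in> J"
    and comm_HE: "H i (E j x) - (E j (H i x) + sc (alpha j $ i) (E j x)) \<in> J"
    and comm_HF: "H i (F j x) - (F j (H i x) - sc (alpha j $ i) (F j x)) \<in> J"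
    and comm_EF: "E i (F j x) - (F j (E i x) + (if i = j then H i x else 0)) \<in> J"
    and E_v0: "E i v0 \<in> J"
    and H_v0: "H i v0 - sc (lam $ i) v0 \<in> J"
begin

definition eqv :: "'v \<Rightarrow> 'v \<Rightarrow> bool" (infix "\<simeq>" 50) where
  "x \<simeq> y \<longleftrightarrow> x - y \<in> J"

lemma eqv_refl [simp]: "x \<simeq> x"
  using subspace_0[OF J_subspace] by (simp add: eqv_def)

lemma eqv_sym: "x \<simeq> y \<Longrightarrow> y \<simeq> x"
  using subspace_neg[OF J_subspace, of "x - y"] by (simp add: eqv_def)

lemma eqv_trans [trans]: "x \<simeq> y \<Longrightarrow> y \<simeq> z \<Longrightarrow> x \<simeq> z"
  using subspace_add[OF J_subspace, of "x - y" "y - z"] by (simp add: eqv_def)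

lemma eqv_add: "x \<simeq> y \<Longrightarrow> x' \<simeq> y' \<Longrightarrow> x + x' \<simeq> y + y'"
  using subspace_add[OF J_subspace, of "x - y" "x' - y'"] by (simp add: eqv_def algebra_simps)

lemma eqv_scale: "x \<simeq> y \<Longrightarrow> sc c x \<simeq> sc c y"
  using subspace_scale[OF J_subspace, of "x - y" c] by (simp add: eqv_def scale_right_diff_distrib)

lemma eqv_diff: "x \<simeq> y \<Longrightarrow> x' \<simeq> y' \<Longrightarrow> x - x' \<simeq> y - y'"
  using subspace_diff[OF J_subspace, of "x - y" "x' - y'"] by (simp add: eqv_def algebra_simps)

lemma eqv_sum: "(\<And>i. i \<in> S \<Longrightarrow> f i \<simeq> g i) \<Longrightarrow> sum f S \<simeq> sum g S"
  by (induction S rule: infinite_finite_induct) (auto intro: eqv_add)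

lemma eqv_0_iff: "x \<simeq> 0 \<longleftrightarrow> x \<in> J"
  by (simp add: eqv_def)

lemma eqv_J: "x \<simeq> y \<Longrightarrow> y \<in> J \<Longrightarrow> x \<in> J"
  using eqv_trans eqv_0_iff by blast

lemma E_0 [simp]: "E i 0 = 0" using E_add[of i 0 0] by simp
lemma F_0 [simp]: "F i 0 = 0" using F_add[of i 0 0] by simp
lemma H_0 [simp]: "H i 0 = 0" using H_add[of i 0 0] by simp

lemma E_diff: "E i (x - y) = E i x - E i y" using E_add[of i "x - y" y] by (simp add: algebra_simps)
lemma F_diff: "F i (x - y) = F i x - F i y" using F_add[of i "x - y" y] by (simp add: algebra_simps)
lemma H_diff: "H i (x - y) = H i x - H i y" using H_add[of i "x - y" y] by (simp add: algebra_simps)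

lemma E_sum: "E i (sum f S) = (\<Sum>k\<in>S. E i (f k))"
  by (induction S rule: infinite_finite_induct) (auto simp: E_add)

lemma E_cong: "x \<simeq> y \<Longrightarrow> E i x \<simeq> E i y" using E_J[of "x - y" i] by (simp add: eqv_def E_diff)
lemma F_cong: "x \<simeq> y \<Longrightarrow> F i x \<simeq> F i y" using F_J[of "x - y" i] by (simp add: eqv_def F_diff)
lemma H_cong: "x \<simeq> y \<Longrightarrow> H i x \<simeq> H i y" using H_J[of "x - y" i] by (simp add: eqv_def H_diff)

lemma EF: "E i (F j x) \<simeq> F j (E i x) + (if i = j then H i x else 0)"
  using comm_EF by (simp add: eqv_def)

section \<open>Weight vectors and separation of weights\<close>

definition weight_vector :: "complex ^ 'i \<Rightarrow> 'v \<Rightarrow> bool" where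
  "weight_vector \<kappa> x \<longleftrightarrow> (\<forall>i. H i x \<simeq> sc (\<kappa> $ i) x)"

lemma weight_vector_v0: "weight_vector lam v0"
  using H_v0 by (simp add: weight_vector_def eqv_def)

lemma weight_vector_0: "weight_vector \<kappa> 0"
  by (simp add: weight_vector_def)

lemma weight_vector_add:
  "weight_vector \<kappa> x \<Longrightarrow> weight_vector \<kappa> y \<Longrightarrow> weight_vector \<kappa> (x + y)"
  by (simp add: weight_vector_def H_add scale_right_distrib eqv_add)

lemma weight_vector_diff:
  "weight_vector \<kappa> x \<Longrightarrow> weight_vector \<kappa> y \<Longrightarrow> weight_vector \<kappa> (x - y)"
  by (simp add: weight_vector_def H_diff scale_right_diff_distrib eqv_diff)

lemma weight_vector_sum:
  "(\<And>i. i \<in> S \<Longrightarrow> weight_vector \<kappa> (f i)) \<Longrightarrow> weight_vector \<kappa> (sum f S)"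
  by (induction S rule: infinite_finite_induct) (auto intro: weight_vector_add weight_vector_0)

lemma weight_vector_scale: "weight_vector \<kappa> x \<Longrightarrow> weight_vector \<kappa> (sc c x)"
  unfolding weight_vector_def
  by (metis H_scale eqv_scale mult.commute scale_scale)

lemma weight_vector_F:
  assumes "weight_vector \<kappa> x"
  shows "weight_vector (\<kappa> - alpha j) (F j x)"
  unfolding weight_vector_def
proof
  fix i
  have "H i (F j x) \<simeq> F j (H i x) - sc (alpha j $ i) (F j x)"
    using comm_HF by (simp add: eqv_def)
  also have "\<dots> \<simeq> F j (sc (\<kappa> $ i) x) - sc (alpha j $ i) (F j x)"
    using assms by (auto simp: weight_vector_def intro!: eqv_diff F_cong)
  finally show "H i (F j x) \<simeq> sc ((\<kappa> - alpha j) $ i) (F j x)"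
    by (simp add: F_scale scale_left_diff_distrib)
qed

lemma weight_vector_E:
  assumes "weight_vector \<kappa> x"
  shows "weight_vector (\<kappa> + alpha j) (E j x)"
  unfolding weight_vector_def
proof
  fix i
  have "H i (E j x) \<simeq> E j (H i x) + sc (alpha j $ i) (E j x)"
    using comm_HE by (simp add: eqv_def)
  also have "\<dots> \<simeq> E j (sc (\<kappa> $ i) x) + sc (alpha j $ i) (E j x)"
    using assms by (auto simp: weight_vector_def intro!: eqv_add E_cong)
  finally show "H i (E j x) \<simeq> sc ((\<kappa> + alpha j) $ i) (E j x)"
    by (simp add: E_scale scale_left_distrib)
qed

text \<open>Members are annihilated modulo \<open>J\<close> by a product of operators \<open>H i - c\<close> with \<open>c \<noteq> \<kappa> $ i\<close>;
  such a product acts on vectors of weight \<open>\<kappa>\<close> by a nonzero scalar.\<close>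

inductive_set off_weight :: "complex ^ 'i \<Rightarrow> 'v set" for \<kappa> where
  off_J: "x \<in> J \<Longrightarrow> x \<in> off_weight \<kappa>"
| off_step: "H i x - sc c x \<in> off_weight \<kappa> \<Longrightarrow> c \<noteq> \<kappa> $ i \<Longrightarrow> x \<in> off_weight \<kappa>"

lemma off_weight_scale: "x \<in> off_weight \<kappa> \<Longrightarrow> sc a x \<in> off_weight \<kappa>"
proof (induction rule: off_weight.induct)
  case (off_J x)
  then show ?case by (simp add: off_weight.off_J subspace_scale[OF J_subspace])
next
  case (off_step i x c)
  then show ?case
    by (intro off_weight.off_step[of i "sc a x" c])
      (auto simp: H_scale scale_right_diff_distrib mult.commute)
qed

lemma off_weight_J_add: "x \<in> off_weight \<kappa> \<Longrightarrow> y \<in> J \<Longrightarrow> x + y \<in> off_weight \<kappa>"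
proof (induction arbitrary: y rule: off_weight.induct)
  case (off_J x)
  then show ?case by (simp add: off_weight.off_J subspace_add[OF J_subspace])
next
  case (off_step i x c)
  have "H i y - sc c y \<in> J"
    using off_step.prems by (intro subspace_diff[OF J_subspace] subspace_scale[OF J_subspace] H_J)
  from off_step.IH[OF this] show ?case
    using off_step.hyps by (intro off_weight.off_step[of i "x + y" c])
      (auto simp: H_add scale_right_distrib algebra_simps)
qed

lemma off_weight_eqv: "x \<in> off_weight \<kappa> \<Longrightarrow> y \<simeq> x \<Longrightarrow> y \<in> off_weight \<kappa>"
  using off_weight_J_add[of x \<kappa> "y - x"] by (simp add: eqv_def)

text \<open>The operators \<open>H j\<close> commute modulo \<open>J\<close>, so a product that
  annihilates \<open>x\<close> also annihilates its image under \<open>H j - d\<close>.\<close>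

lemma off_weight_H: "x \<in> off_weight \<kappa> \<Longrightarrow> H j x - sc d x \<in> off_weight \<kappa>"
proof (induction rule: off_weight.induct)
  case (off_J x)
  then show ?case
    by (intro off_weight.off_J subspace_diff[OF J_subspace] subspace_scale[OF J_subspace] H_J)
next
  case (off_step i x c)
  have "H i (H j x - sc d x) - sc c (H j x - sc d x)
      - (H j (H i x - sc c x) - sc d (H i x - sc c x)) = H i (H j x) - H j (H i x)"
    by (simp add: H_diff H_scale scale_right_diff_distrib mult.commute)
  then have "H i (H j x - sc d x) - sc c (H j x - sc d x)
      \<simeq> H j (H i x - sc c x) - sc d (H i x - sc c x)"
    using comm_HH by (simp add: eqv_def)
  then show ?case
    using off_weight_eqv off_step by (intro off_weight.off_step[of i "H j x - sc d x" c]) auto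
qed

text \<open>Concatenate the two annihilating products: every factor applied on behalf of
  \<open>x\<close> leaves \<open>y\<close> in \<open>off_weight \<kappa>\<close> by
  \<open>off_weight_H\<close>, which is why \<open>y\<close> is arbitrary in the induction.\<close>

lemma off_weight_add: "x \<in> off_weight \<kappa> \<Longrightarrow> y \<in> off_weight \<kappa> \<Longrightarrow> x + y \<in> off_weight \<kappa>"
proof (induction arbitrary: y rule: off_weight.induct)
  case (off_J x)
  then show ?case using off_weight_J_add[of y \<kappa> x] by (simp add: add.commute)
next
  case (off_step i x c)
  from off_step.IH[OF off_weight_H[OF off_step.prems, of i c]] show ?case
    using off_step.hyps by (intro off_weight.off_step[of i "x + y" c])
      (auto simp: H_add scale_right_distrib algebra_simps)
qed

lemma weight_vector_off_weight:
  assumes "weight_vector \<eta> x" "\<eta> \<noteq> \<kappa>"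
  shows "x \<in> off_weight \<kappa>"
proof -
  obtain i where i: "\<eta> $ i \<noteq> \<kappa> $ i" using assms(2) by (auto simp: vec_eq_iff)
  show ?thesis
    using assms(1) i
    by (intro off_step[of i x "\<eta> $ i", OF off_J]) (auto simp: weight_vector_def eqv_def)
qed

lemma weight_vector_eqv: "weight_vector \<kappa> x \<Longrightarrow> y \<simeq> x \<Longrightarrow> weight_vector \<kappa> y"
  unfolding weight_vector_def by (meson H_cong eqv_scale eqv_sym eqv_trans)

text \<open>This stands in for the directness of the sum of weight spaces: a sum of vectors of
  weights other than \<kappa> that itself has weight \<kappa> is zero in the quotient.\<close>

lemma off_weight_imp_J:
  "x \<in> off_weight \<kappa> \<Longrightarrow> weight_vector \<kappa> x \<Longrightarrow> x \<in> J"
proof (induction rule: off_weight.induct)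
  case (off_step i x c)
  have "H i x \<simeq> sc (\<kappa> $ i) x" using off_step.prems by (simp add: weight_vector_def)
  then have *: "H i x - sc c x \<simeq> sc (\<kappa> $ i - c) x"
    using eqv_diff[OF _ eqv_refl] by (simp add: scale_left_diff_distrib)
  then have "H i x - sc c x \<in> J"
    using off_step.IH weight_vector_eqv weight_vector_scale off_step.prems by blast
  with * have "sc (\<kappa> $ i - c) x \<in> J" using eqv_J eqv_sym by blast
  then have "sc (1 / (\<kappa> $ i - c)) (sc (\<kappa> $ i - c) x) \<in> J"
    by (rule subspace_scale[OF J_subspace])
  with off_step.hyps show ?case by simp
qed

section \<open>Words in the lowering operators\<close>

definition word_weight :: "'i list \<Rightarrow> complex ^ 'i" where
  "word_weight is = sum_list (map alpha is)"

lemma weight_vector_foldr_F: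
  "weight_vector \<kappa> x \<Longrightarrow> weight_vector (\<kappa> - word_weight is) (foldr F is x)"
proof (induction "is")
  case (Cons i "is")
  have "\<kappa> - word_weight is - alpha i = \<kappa> - word_weight (i # is)"
    by (simp add: word_weight_def algebra_simps)
  with weight_vector_F[OF Cons.IH[OF Cons.prems], of i] show ?case by simp
qed (simp add: word_weight_def)

text \<open>The set \<open>W\<close> is a parameter because two cases matter: all words give the
  submodule generated by a singular vector, and nonempty words applied to the highest weight vector
  give the part of lower weight. Including \<open>J\<close> makes membership independent of
  representatives.\<close>

inductive_set F_span :: "'i list set \<Rightarrow> 'v \<Rightarrow> 'v set" for W x where
  F_span_J: "y \<in> J \<Longrightarrow> y \<in> F_span W x"
| F_span_add: "y \<in> F_span W x \<Longrightarrow> z \<in> F_span W x \<Longrightarrow> y + z \<in> F_span W x"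
| F_span_word: "is \<in> W \<Longrightarrow> sc c (foldr F is x) \<in> F_span W x"

lemma F_span_scale: "y \<in> F_span W x \<Longrightarrow> sc c y \<in> F_span W x"
proof (induction rule: F_span.induct)
  case (F_span_word "is" d)
  then show ?case using F_span.F_span_word[of "is" W "c * d"] by simp
qed (auto intro: F_span.intros simp: subspace_scale[OF J_subspace] scale_right_distrib)

lemma F_span_diff: "y \<in> F_span W x \<Longrightarrow> z \<in> F_span W x \<Longrightarrow> y - z \<in> F_span W x"
  using F_span_add[OF _ F_span_scale[of z W x "-1"], of y] by simp

lemma F_span_eqv: "y \<in> F_span W x \<Longrightarrow> z \<simeq> y \<Longrightarrow> z \<in> F_span W x"
  using F_span_add[OF _ F_span_J[of "z - y"], of y] by (simp add: eqv_def)

lemma F_span_F: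
  "y \<in> F_span W x \<Longrightarrow> (\<And>is. is \<in> W \<Longrightarrow> i # is \<in> W') \<Longrightarrow> F i y \<in> F_span W' x"
proof (induction rule: F_span.induct)
  case (F_span_word "is" c)
  then show ?case using F_span.F_span_word[of "i # is" W' c x] by (simp add: F_scale)
qed (auto simp: F_J F_add intro: F_span.intros)

lemma F_span_H:
  assumes "y \<in> F_span W x" "weight_vector \<kappa> x"
  shows "H i y \<in> F_span W x"
  using assms(1)
proof (induction rule: F_span.induct)
  case (F_span_word "is" c)
  have "H i (sc c (foldr F is x)) \<simeq> sc ((\<kappa> - word_weight is) $ i) (sc c (foldr F is x))"
    using weight_vector_scale[OF weight_vector_foldr_F[OF assms(2)]]
    unfolding weight_vector_def by blast
  then show ?case
    using F_span_eqv F_span.F_span_word F_span_scale F_span_word by blast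
qed (auto simp: H_J H_add intro: F_span.intros)

text \<open>The empty word is killed modulo \<open>J\<close> by \<open>H i - \<kappa> $ i\<close>,
  and the span of the nonempty words is stable under \<open>H i\<close>. This treats the generators
  h_i - h_i(lam) of the dual ideal.\<close>

lemma F_span_H_diff:
  assumes "y \<in> F_span UNIV x" "weight_vector \<kappa> x"
  shows "H i y - sc (\<kappa> $ i) y \<in> F_span {is. is \<noteq> []} x"
  using assms(1)
proof (induction rule: F_span.induct)
  case (F_span_J y)
  then show ?case
    by (intro F_span.F_span_J subspace_diff[OF J_subspace] subspace_scale[OF J_subspace] H_J)
next
  case (F_span_add y z)
  then show ?case
    using F_span.F_span_add by (fastforce simp: H_add scale_right_distrib algebra_simps)
next
  case (F_span_word "is" c)
  show ?case
  proof (cases "is = []")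
    case True
    then show ?thesis
      using weight_vector_scale[OF assms(2), of c]
      by (auto simp: weight_vector_def eqv_def intro!: F_span.F_span_J)
  next
    case False
    then have "sc c (foldr F is x) \<in> F_span {is. is \<noteq> []} x" by (intro F_span.F_span_word) simp
    then show ?thesis using F_span_H[OF _ assms(2)] F_span_scale F_span_diff by blast
  qed
qed

text \<open>Move \<open>E i\<close> through the word from left to right. Each exchange leaves at
  most an \<open>H\<close> term, which stays in the span, and \<open>E i\<close> finally reaches
  \<open>x\<close>, where it gives an element of \<open>J\<close>.\<close>

lemma F_span_E:
  assumes "y \<in> F_span UNIV x" "weight_vector \<kappa> x" "\<And>j. E j x \<in> J"
  shows "E i y \<in> F_span UNIV x"
  using assms(1)
proof (induction rule: F_span.induct)
  case (F_span_word "is" c)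
  have "E i (foldr F is x) \<in> F_span UNIV x"
  proof (induction "is")
    case Nil
    then show ?case by (simp add: assms(3) F_span_J)
  next
    case (Cons j "is")
    have "foldr F is x \<in> F_span UNIV x" using F_span.F_span_word[of "is" UNIV 1] by simp
    then have "(if i = j then H i (foldr F is x) else 0) \<in> F_span UNIV x"
      using F_span_H[OF _ assms(2)] F_span_J subspace_0[OF J_subspace] by auto
    then show ?case
      using F_span_eqv[OF F_span_add EF] F_span_F[OF Cons] by auto
  qed
  then show ?case by (simp add: E_scale F_span_scale)
qed (auto simp: E_J E_add intro: F_span.intros)

lemma F_span_off_weight:
  assumes "y \<in> F_span W x" "weight_vector \<eta> x" "\<And>is. is \<in> W \<Longrightarrow> \<eta> - word_weight is \<noteq> \<kappa>"
  shows "y \<in> off_weight \<kappa>"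
  using assms(1)
proof (induction rule: F_span.induct)
  case (F_span_word "is" c)
  then show ?case
    using weight_vector_off_weight[OF weight_vector_foldr_F[OF assms(2)] assms(3)] off_weight_scale
    by blast
qed (auto intro: off_J off_weight_add)

definition root_sum :: "('i \<Rightarrow> nat) \<Rightarrow> complex ^ 'i" where
  "root_sum n = (\<Sum>i\<in>UNIV. of_nat (n i) *s alpha i)"

lemma root_sum_incr: "root_sum (incr j n) = root_sum n + alpha j"
proof -
  have "root_sum (incr j n) = (\<Sum>i\<in>UNIV. of_nat (n i) *s alpha i + (if i = j then alpha i else 0))"
    unfolding root_sum_def by (rule sum.cong) (auto simp: incr_def vector_add_ldistrib vec.scale_left_distrib)
  then show ?thesis by (simp add: sum.distrib root_sum_def)
qed

lemma word_weight_eq_root_sum: "word_weight is = root_sum (\<lambda>i. count_list is i)"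
proof (induction "is")
  case (Cons j "is")
  have "(\<lambda>i. count_list (j # is) i) = incr j (\<lambda>i. count_list is i)"
    by (auto simp: incr_def)
  with Cons show ?case by (simp add: root_sum_incr) (simp add: word_weight_def)
qed (simp add: word_weight_def root_sum_def)

end

text \<open>The assumptions on \<open>c\<close> are what the induction uses of the Casimir gap. Its
  increment is \<open>d j\<close> times the weight of degree \<open>n\<close> evaluated at h_j,
  which is the scalar produced by the commutator of \<open>E j\<close> and
  \<open>F j\<close>.\<close>

locale whittaker_recursion = highest_weight_module sc J E F H alpha lam v0
  for sc :: "complex \<Rightarrow> 'v::ab_group_add \<Rightarrow> 'v" and J and E F H :: "'i::finite \<Rightarrow> 'v \<Rightarrow> 'v"
    and alpha lam v0 +
  fixes c :: "('i \<Rightarrow> nat) \<Rightarrow> complex" and d \<mu> :: "'i \<Rightarrow> complex"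
  assumes c_0: "c (\<lambda>_. 0) = 0"
    and c_nonzero: "n \<noteq> (\<lambda>_. 0) \<Longrightarrow> c n \<noteq> 0"
    and c_incr: "c (incr j n) = c n + d j * (lam - root_sum n) $ j"
begin

text \<open>The guard \<open>n i = 0\<close> stands for a component at a negative multiplicity,
  which is zero. It also secures termination, since truncated subtraction would make
  \<open>decr i n\<close> equal to \<open>n\<close>.\<close>

function whittaker :: "('i \<Rightarrow> nat) \<Rightarrow> 'v" where
  "whittaker n = (if n = (\<lambda>_. 0) then v0 else sc (1 / c n)
     (\<Sum>i\<in>UNIV. if n i = 0 then 0 else sc (d i * \<mu> i) (F i (whittaker (decr i n)))))"
  by pat_completeness auto
termination
  by (relation "measure (\<lambda>n. \<Sum>i\<in>UNIV. n i)") (auto simp: sum_decr_less)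

declare whittaker.simps [simp del]

lemma whittaker_0: "whittaker (\<lambda>_. 0) = v0"
  by (subst whittaker.simps) simp

lemma whittaker_recursion:
  "sc (c n) (whittaker n) = (\<Sum>i\<in>UNIV. if n i = 0 then 0 else sc (d i * \<mu> i) (F i (whittaker (decr i n))))"
proof (cases "n = (\<lambda>_. 0)")
  case False
  then show ?thesis by (subst whittaker.simps) (simp add: c_nonzero)
qed (simp add: c_0)

lemma weight_vector_whittaker: "weight_vector (lam - root_sum n) (whittaker n)"
proof (induction "\<Sum>i\<in>UNIV. n i" arbitrary: n rule: less_induct)
  case less
  show ?case
  proof (cases "n = (\<lambda>_. 0)")
    case True
    then show ?thesis by (simp add: whittaker_0 root_sum_def weight_vector_v0)
  next
    case False
    have "weight_vector (lam - root_sum n) (sc (d i * \<mu> i) (F i (whittaker (decr i n))))"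
      if "n i \<noteq> 0" for i
      using weight_vector_scale[OF weight_vector_F[OF less[OF sum_decr_less[of n i, OF that]], of i]]
        root_sum_incr[of i "decr i n"] that
      by (simp add: incr_decr diff_diff_eq)
    then have "weight_vector (lam - root_sum n) (sc (1 / c n) (sc (c n) (whittaker n)))"
      unfolding whittaker_recursion
      by (auto intro!: weight_vector_scale weight_vector_sum weight_vector_0)
    with False show ?thesis by (simp add: c_nonzero)
  qed
qed

lemma E_whittaker: "E j (whittaker n) \<simeq> (if n j = 0 then 0 else sc (\<mu> j) (whittaker (decr j n)))"
proof (induction "\<Sum>i\<in>UNIV. n i" arbitrary: n rule: less_induct)
  case less
  show ?case
  proof (cases "n = (\<lambda>_. 0)")
    case True
    then show ?thesis by (simp add: whittaker_0 E_v0 eqv_0_iff)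
  next
    case False
    define t where "t m i = (if m i = 0 then 0 else sc (d i * \<mu> i) (F i (whittaker (decr i m))))" for m i
    \<comment> \<open>This is \<open>c n\<close> times the claimed value; the division by
      \<open>c n\<close> comes last.\<close>
    define R where "R = (if n j = 0 then 0 else sc (c n) (sc (\<mu> j) (whittaker (decr j n))))"
    \<comment> \<open>Exchange \<open>E j\<close> and \<open>F i\<close>: the induction hypothesis
      evaluates \<open>E j\<close> on the smaller component, and for \<open>i = j\<close> the
      commutator contributes the weight of that component.\<close>
    have IH: "E j (F i (whittaker (decr i n))) \<simeq>
        F i (if decr i n j = 0 then 0 else sc (\<mu> j) (whittaker (decr j (decr i n))))
        + (if j = i then sc ((lam - root_sum (decr i n)) $ j) (whittaker (decr i n)) else 0)"
      if "n i \<noteq> 0" for i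
      using weight_vector_whittaker[of "decr i n"] less[OF sum_decr_less[of n i, OF that]]
      by (intro eqv_trans[OF EF] eqv_add F_cong) (auto simp: weight_vector_def)
    have "sc (c n) (E j (whittaker n)) = (\<Sum>i\<in>UNIV. E j (t n i))"
      by (simp add: whittaker_recursion E_sum t_def flip: E_scale)
    also have "\<dots> \<simeq> R"
    proof (cases "n j = 0")
      case True
      have "E j (t n i) \<simeq> 0" for i
      proof (cases "n i = 0")
        case False
        then have "decr i n j = 0" "j \<noteq> i" using True by (auto simp: decr_def)
        with IH[OF False] have "E j (F i (whittaker (decr i n))) \<simeq> 0" by simp
        from eqv_scale[OF this, of "d i * \<mu> i"] False show ?thesis by (simp add: t_def E_scale)
      qed (simp add: t_def)
      then have "(\<Sum>i\<in>UNIV. E j (t n i)) \<simeq> (\<Sum>i\<in>(UNIV::'i set). 0)" by (intro eqv_sum)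
      with True show ?thesis by (simp add: R_def)
    next
      case nj: False
      define m where "m = decr j n"
      have n_eq: "n = incr j m" using nj by (simp add: m_def incr_decr)
      \<comment> \<open>Summed over \<open>i\<close>, the first terms reassemble the recursion at
        \<open>m\<close> into \<open>c m\<close> times the component at \<open>m\<close>. With the
        one commutator term, \<open>c_incr\<close> then turns \<open>c m\<close> into
        \<open>c n\<close>.\<close>
      have "E j (t n i) \<simeq> sc (\<mu> j) (t m i)
          + (if i = j then sc (\<mu> j * (d j * (lam - root_sum m) $ j)) (whittaker m) else 0)" for i
      proof (cases "n i = 0")
        case True
        then have "m i = 0" "i \<noteq> j" using nj by (auto simp: m_def decr_def)
        with True show ?thesis by (simp add: t_def)
      next
        case False
        have comm: "decr j (decr i n) = decr i m" by (auto simp: decr_def m_def fun_eq_iff)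
        show ?thesis
        proof (cases "i = j")
          case True
          have "E j (t n i) = sc (d j * \<mu> j) (E j (F j (whittaker m)))"
            using True nj by (simp add: t_def E_scale m_def)
          also have "\<dots> \<simeq> sc (d j * \<mu> j)
             (F j (if m j = 0 then 0 else sc (\<mu> j) (whittaker (decr j m))) + sc ((lam - root_sum m) $ j) (whittaker m))"
            using IH[OF nj] by (intro eqv_scale) (auto simp: m_def split: if_splits)
          also have "\<dots> = sc (\<mu> j) (t m j) + sc (\<mu> j * (d j * (lam - root_sum m) $ j)) (whittaker m)"
            by (simp add: t_def F_scale scale_right_distrib mult_ac)
          finally show ?thesis using True by simp
        next
          case ij: False
          have "E j (t n i) = sc (d i * \<mu> i) (E j (F i (whittaker (decr i n))))"
            using False by (simp add: t_def E_scale)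
          also have "\<dots> \<simeq> sc (d i * \<mu> i) (F i (sc (\<mu> j) (whittaker (decr i m))))"
            using IH[OF False] ij nj comm by (intro eqv_scale) (simp add: decr_def)
          also have "\<dots> = sc (\<mu> j) (t m i)"
            using ij False by (simp add: t_def F_scale mult_ac) (simp add: m_def decr_def)
          finally show ?thesis using ij by simp
        qed
      qed
      then have "(\<Sum>i\<in>UNIV. E j (t n i)) \<simeq> (\<Sum>i\<in>UNIV. sc (\<mu> j) (t m i)
          + (if i = j then sc (\<mu> j * (d j * (lam - root_sum m) $ j)) (whittaker m) else 0))"
        by (intro eqv_sum)
      also have "\<dots> = sc (\<mu> j) (\<Sum>i\<in>UNIV. t m i) + sc (\<mu> j * (d j * (lam - root_sum m) $ j)) (whittaker m)"
        by (simp add: sum.distrib scale_sum_right)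
      also have "(\<Sum>i\<in>UNIV. t m i) = sc (c m) (whittaker m)"
        by (simp add: whittaker_recursion t_def)
      also have "sc (\<mu> j) (sc (c m) (whittaker m)) + sc (\<mu> j * (d j * (lam - root_sum m) $ j)) (whittaker m) = R"
        using nj by (simp add: R_def n_eq c_incr flip: m_def scale_left_distrib) (simp add: n_eq[symmetric] m_def[symmetric] algebra_simps)
      finally show ?thesis .
    qed
    finally have "sc (1 / c n) (sc (c n) (E j (whittaker n))) \<simeq> sc (1 / c n) R"
      by (rule eqv_scale)
    with c_nonzero[OF False] show ?thesis by (simp add: R_def split: if_splits)
  qed
qed

end

section \<open>The free algebra and its ideals\<close>

lemma poly_mapping_single_induct:
  assumes "P 0" "\<And>k c. P (Poly_Mapping.single k c)" "\<And>x y. P x \<Longrightarrow> P y \<Longrightarrow> P (x + y)"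
  shows "P (x :: 'k \<Rightarrow>\<^sub>0 'b::comm_monoid_add)"
proof (induction x rule: update_induct)
  case const
  then show ?case by fact
next
  case (update f a b)
  have "Poly_Mapping.update a b f = f + Poly_Mapping.single a b"
    using update.hyps
    by (intro poly_mapping_eqI) (auto simp: lookup_update lookup_add lookup_single in_keys_iff when_def)
  with update assms show ?case by simp
qed

lemma free_algebra_induct [case_names const gen add]:
  assumes "\<And>c. P (const c)" "\<And>g x. P x \<Longrightarrow> P (gen g * x)" "\<And>x y. P x \<Longrightarrow> P y \<Longrightarrow> P (x + y)"
  shows "P x"
proof (induction x rule: poly_mapping_single_induct)
  case 1
  show ?case using assms(1)[of 0] by (simp add: const_def)
next
  case (2 k c)
  obtain xs where "k = Word xs" by (cases k)
  moreover have "P (Poly_Mapping.single (Word xs) c)"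
  proof (induction xs)
    case Nil
    show ?case using assms(1)[of c] by (simp add: const_def zero_free_monoid_def)
  next
    case (Cons g xs)
    then show ?case using assms(2)[OF Cons, of g] by (simp add: gen_def mult_single)
  qed
  ultimately show ?case by simp
qed (rule assms(3))

lemma const_add: "const (a + b) = const a + const b"
  by (simp add: const_def single_add)

lemma const_mult: "const (a * b) = const a * const b"
  by (simp add: const_def mult_single)

lemma const_0 [simp]: "const 0 = 0"
  by (simp add: const_def)

lemma const_1 [simp]: "const 1 = 1"
  by (simp add: const_def)

lemma const_uminus: "const (- a) = - const a"
  by (simp add: const_def single_uminus)

text \<open>Constants are supported on the empty word, hence central. So \<open>const c * x\<close>
  is the scalar multiplication for left and right modules alike.\<close>

lemma const_commute: "x * const c = const c * x"
proof (induction x rule: poly_mapping_single_induct)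
  case (2 k d)
  then show ?case by (simp add: const_def mult_single mult.commute)
qed (simp_all add: distrib_left distrib_right)

lemma const_left_commute: "x * (const c * y) = const c * (x * y)"
  by (simp add: const_commute flip: mult.assoc)

lemma vector_space_const: "vector_space (\<lambda>c x. const c * x)"
  by unfold_locales (auto simp: const_add const_mult algebra_simps)

text \<open>Closure under intersections is what makes the \<open>hull\<close> of a set an ideal
  again, through \<open>hull_in\<close>.\<close>

lemma left_ideal_Inter: "Ball T left_ideal \<Longrightarrow> left_ideal (\<Inter>T)"
  unfolding left_ideal_def by simp

lemma right_ideal_Inter: "Ball T right_ideal \<Longrightarrow> right_ideal (\<Inter>T)"
  unfolding right_ideal_def by simp

lemma two_sided_ideal_Inter: "Ball T two_sided_ideal \<Longrightarrow> two_sided_ideal (\<Inter>T)"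
  using left_ideal_Inter[of T] right_ideal_Inter[of T] by (simp add: two_sided_ideal_def)

lemma left_ideal_verma_ideal: "left_ideal (verma_ideal L lam)"
  unfolding verma_ideal_def by (rule hull_in) (rule left_ideal_Inter)

lemma right_ideal_dual_verma_ideal: "right_ideal (dual_verma_ideal L lam)"
  unfolding dual_verma_ideal_def by (rule hull_in) (rule right_ideal_Inter)

lemma two_sided_ideal_enveloping_ideal: "two_sided_ideal (enveloping_ideal L)"
  unfolding enveloping_ideal_def by (rule hull_in) (rule two_sided_ideal_Inter)

lemma left_idealD:
  assumes "left_ideal J"
  shows "0 \<in> J" "x \<in> J \<Longrightarrow> y \<in> J \<Longrightarrow> x + y \<in> J" "x \<in> J \<Longrightarrow> a * x \<in> J"
    "x \<in> J \<Longrightarrow> - x \<in> J" "x \<in> J \<Longrightarrow> y \<in> J \<Longrightarrow> x - y \<in> J"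
proof -
  show *: "0 \<in> J" "x \<in> J \<Longrightarrow> y \<in> J \<Longrightarrow> x + y \<in> J" "x \<in> J \<Longrightarrow> a * x \<in> J" for x y a
    using assms by (auto simp: left_ideal_def)
  show **: "x \<in> J \<Longrightarrow> - x \<in> J" for x using *(3)[of x "-1"] by simp
  show "x \<in> J \<Longrightarrow> y \<in> J \<Longrightarrow> x - y \<in> J" using *(2)[OF _ **, of x y] by simp
qed

lemma right_idealD:
  assumes "right_ideal J"
  shows "0 \<in> J" "x \<in> J \<Longrightarrow> y \<in> J \<Longrightarrow> x + y \<in> J" "x \<in> J \<Longrightarrow> x * a \<in> J"
    "x \<in> J \<Longrightarrow> - x \<in> J" "x \<in> J \<Longrightarrow> y \<in> J \<Longrightarrow> x - y \<in> J"
proof -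
  show *: "0 \<in> J" "x \<in> J \<Longrightarrow> y \<in> J \<Longrightarrow> x + y \<in> J" "x \<in> J \<Longrightarrow> x * a \<in> J" for x y a
    using assms by (auto simp: right_ideal_def)
  show **: "x \<in> J \<Longrightarrow> - x \<in> J" for x using *(3)[of x "-1"] by simp
  show "x \<in> J \<Longrightarrow> y \<in> J \<Longrightarrow> x - y \<in> J" using *(2)[OF _ **, of x y] by simp
qed

lemmas verma_idealD = left_idealD[OF left_ideal_verma_ideal]
lemmas dual_verma_idealD = right_idealD[OF right_ideal_dual_verma_ideal]
lemmas enveloping_idealD =
  left_idealD[OF conjunct1[OF two_sided_ideal_enveloping_ideal[unfolded two_sided_ideal_def]]]
  right_idealD(3)[OF conjunct2[OF two_sided_ideal_enveloping_ideal[unfolded two_sided_ideal_def]]]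

lemma enveloping_ideal_le_verma_ideal: "x \<in> enveloping_ideal L \<Longrightarrow> x \<in> verma_ideal L lam"
  unfolding verma_ideal_def by (rule hull_inc) simp

lemma enveloping_ideal_le_dual_verma_ideal: "x \<in> enveloping_ideal L \<Longrightarrow> x \<in> dual_verma_ideal L lam"
  unfolding dual_verma_ideal_def by (rule hull_inc) simp

lemma gen_add: "gen (x + y) - gen x - gen y \<in> enveloping_ideal L"
  unfolding enveloping_ideal_def by (rule hull_inc) blast

lemma gen_scale: "gen (scale L c x) - const c * gen x \<in> enveloping_ideal L"
  unfolding enveloping_ideal_def by (rule hull_inc) blast

lemma gen_bracket: "gen x * gen y - gen y * gen x - gen (bracket L x y) \<in> enveloping_ideal L"
  unfolding enveloping_ideal_def by (rule hull_inc) blast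

section \<open>Generation, centre and the Cartan matrix\<close>

context simple_lie_algebra
begin

lemma bracket_0_left [simp]: "bracket L 0 x = 0"
  using bracket_add_left[of 0 0 x] by simp

lemma bracket_0_right [simp]: "bracket L x 0 = 0"
  using bracket_add_right[of x 0 0] by simp

lemma bracket_swap: "bracket L x y = - bracket L y x"
proof -
  have "bracket L (x + y) (x + y) = bracket L x y + bracket L y x"
    unfolding bracket_add_left bracket_add_right by (simp add: bracket_self)
  then show ?thesis by (simp add: bracket_self eq_neg_iff_add_eq_0)
qed

lemma gen_0: "gen 0 \<in> enveloping_ideal L"
  using gen_scale[of L 0 0] by simp

text \<open>By the triangular decomposition the Chevalley generators generate everything. The lemma
  serves as an induction principle on the Lie algebra: a property that defines a subalgebra has to
  be checked on generators only.\<close>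

lemma subalgebra_generated:
  assumes "subalgebra S" "range (chev_e L) \<subseteq> S" "range (chev_f L) \<subseteq> S" "range (chev_h L) \<subseteq> S"
  shows "S = UNIV"
proof -
  have S: "subspace S" using assms(1) by (simp add: subalgebra_def)
  have "nilp_pos L \<subseteq> S" "nilp_neg L \<subseteq> S"
    unfolding nilp_pos_def nilp_neg_def using assms by (simp_all add: hull_minimal)
  moreover have "cartan_subalgebra L \<subseteq> S"
    unfolding cartan_subalgebra_def using assms(4) S by (rule span_minimal)
  moreover have "\<exists>y z x. y \<in> nilp_neg L \<and> z \<in> cartan_subalgebra L \<and> x \<in> nilp_pos L \<and> v = y + z + x" for v
    using ex1_implies_ex[OF triangular[of v]] by auto
  ultimately show ?thesis
    using subspace_add[OF S] by (metis UNIV_eq_I subsetD)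
qed

text \<open>The line through a central element is an ideal. If it were everything, the bracket would
  vanish identically, which simplicity excludes.\<close>

lemma trivial_center:
  assumes "\<And>x. bracket L x z = 0"
  shows "z = 0"
proof (rule ccontr)
  assume "z \<noteq> 0"
  have 0: "bracket L x y = 0" if "y \<in> span {z}" for x y
    using that assms by (auto simp: span_singleton bracket_scale_right)
  have "lie_ideal (span {z})"
    unfolding lie_ideal_def by (auto simp: 0 span_zero)
  moreover have "z \<in> span {z}" by (simp add: span_base)
  ultimately have "span {z} = UNIV" using simple \<open>z \<noteq> 0\<close> unfolding simple_algebra_def by blast
  with 0 simple show False unfolding simple_algebra_def by blast
qed

text \<open>A kernel vector \<open>v\<close> makes the sum of the v_j h_j commute with all Chevalley
  generators. Its centraliser is a subalgebra by the Jacobi identity, so the sum is central, hence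
  zero, and independence of the h_j gives \<open>v = 0\<close>.\<close>

lemma cartan_matrix_ker:
  fixes v :: "'i \<Rightarrow> complex"
  assumes "\<And>i. (\<Sum>j\<in>UNIV. of_int (cartan L i j) * v j) = 0"
  shows "v j = 0"
proof -
  define z where "z = (\<Sum>j\<in>UNIV. scale L (v j) (chev_h L j))"
  have sum_left: "bracket L (\<Sum>j\<in>S. f j) x = (\<Sum>j\<in>S. bracket L (f j) x)"
    for f :: "'i \<Rightarrow> 'g" and S x
    by (induction S rule: infinite_finite_induct) (auto simp: bracket_add_left)
  have subalg: "subalgebra {x. bracket L z x = 0}"
    unfolding subalgebra_def
  proof (intro conjI ballI)
    show "subspace {x. bracket L z x = 0}"
      by (rule subspaceI) (auto simp: bracket_add_right bracket_scale_right)
    fix x y assume "x \<in> {x. bracket L z x = 0}" "y \<in> {x. bracket L z x = 0}"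
    then show "bracket L x y \<in> {x. bracket L z x = 0}"
      using jacobi[of z x y] bracket_swap[of y z] by simp
  qed
  have e: "bracket L z (chev_e L i) = 0" for i
    unfolding z_def sum_left
    using arg_cong[OF assms[of i], of "\<lambda>c. scale L c (chev_e L i)"]
    by (simp add: bracket_scale_left bracket_h_e scale_sum_left mult.commute)
  have f: "bracket L z (chev_f L i) = 0" for i
    unfolding z_def sum_left
    using arg_cong[OF assms[of i], of "\<lambda>c. - scale L c (chev_f L i)"]
    by (simp add: bracket_scale_left bracket_h_f scale_sum_left mult.commute sum_negf)
  have h: "bracket L z (chev_h L i) = 0" for i
    unfolding z_def sum_left by (simp add: bracket_scale_left bracket_h_h)
  have "{x. bracket L z x = 0} = UNIV"
    by (rule subalgebra_generated[OF subalg]) (auto simp: e f h)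
  then have "bracket L z x = 0" for x by blast
  then have "bracket L x z = 0" for x using bracket_swap[of x z] by simp
  then have "z = 0" by (rule trivial_center)
  \<comment> \<open>\<open>independentD\<close> speaks about a set of vectors, so the sum is
    reindexed along the injection \<open>chev_h L\<close>.\<close>
  moreover have "(\<Sum>x\<in>range (chev_h L). scale L (v (inv (chev_h L) x)) x) = z"
    using h_inj by (simp add: sum.reindex z_def)
  ultimately have "v (inv (chev_h L) (chev_h L j)) = 0"
    by (intro independentD[OF h_independent _ subset_refl]) auto
  then show ?thesis by (simp add: h_inj)
qed

text \<open>The simple roots are the rows of the Cartan matrix, which is invertible as its kernel is
  trivial. Independence separates the weights in lam - Q_+; spanning extends statements about the
  form from simple roots to all weights.\<close>

lemma simple_roots_basis:
  shows simple_roots_span: "\<exists>x. \<kappa> = (\<Sum>i\<in>UNIV. x i *s simple_root L i)"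
    and simple_roots_independent:
      "(\<Sum>i\<in>UNIV. x i *s simple_root L i) = 0 \<Longrightarrow> x i = 0"
proof -
  define A :: "complex ^ 'i ^ 'i" where "A = (\<chi> i j. of_int (cartan L i j))"
  have "\<exists>B. B ** A = mat 1"
    unfolding matrix_left_invertible_ker
  proof (intro allI impI)
    fix v assume "A *v v = 0"
    then have "(\<Sum>j\<in>UNIV. of_int (cartan L i j) * v $ j) = 0" for i
      by (simp add: A_def matrix_vector_mult_def vec_eq_iff)
    from cartan_matrix_ker[OF this] show "v = 0" by (simp add: vec_eq_iff)
  qed
  then obtain B where B: "B ** A = mat 1" by blast
  then have B': "A ** B = mat 1" by (simp add: matrix_left_right_inverse)
  have comb: "(\<Sum>i\<in>UNIV. x $ i *s simple_root L i) = x v* A" for x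
    by (simp add: vector_matrix_mult_def vec_eq_iff A_def simple_root_def sum_component mult.commute)
  show "\<exists>x. \<kappa> = (\<Sum>i\<in>UNIV. x i *s simple_root L i)"
  proof (intro exI)
    show "\<kappa> = (\<Sum>i\<in>UNIV. (\<kappa> v* B) $ i *s simple_root L i)"
      unfolding comb by (simp add: vector_matrix_mul_assoc B)
  qed
  assume "(\<Sum>i\<in>UNIV. x i *s simple_root L i) = 0"
  then have "(\<chi> i. x i) v* A = 0" using comb[of "\<chi> i. x i"] by simp
  then have "(\<chi> i. x i) v* A v* B = 0" by simp
  then show "x i = 0" unfolding vector_matrix_mul_assoc B' by (simp add: vec_eq_iff)
qed

lemma root_comb_inj: "root_comb L n = root_comb L m \<longleftrightarrow> n = m"
proof
  assume *: "root_comb L n = root_comb L m"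
  have "(\<Sum>i\<in>UNIV. (of_nat (n i) - of_nat (m i)) *s simple_root L i) = 0"
    using * by (simp add: root_comb_def vec.scale_left_diff_distrib sum_subtractf)
  from simple_roots_independent[OF this] show "n = m" by (simp add: fun_eq_iff)
qed simp

end

section \<open>Cosets and the operations on them\<close>

lemma coset_alt: "coset J a = {b. a - b \<in> J}"
  by (auto simp: coset_def cong_mod_def)

lemma coset_UN:
  assumes "S \<noteq> {}" "\<And>s. s \<in> S \<Longrightarrow> f s = A"
  shows "(\<Union>s\<in>S. f s) = A"
  using assms by auto

context
  fixes J :: "'r::ring_1 set"
  assumes J_0: "0 \<in> J" and J_add: "\<And>x y. x \<in> J \<Longrightarrow> y \<in> J \<Longrightarrow> x + y \<in> J"
    and J_diff: "\<And>x y. x \<in> J \<Longrightarrow> y \<in> J \<Longrightarrow> x - y \<in> J"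
begin

lemma coset_eq_iff: "coset J a = coset J b \<longleftrightarrow> a - b \<in> J"
proof
  assume "coset J a = coset J b"
  moreover have "b \<in> coset J b" by (simp add: coset_alt J_0)
  ultimately have "b \<in> coset J a" by simp
  then show "a - b \<in> J" by (simp add: coset_alt)
next
  assume "a - b \<in> J"
  then show "coset J a = coset J b"
    using J_add[of "a - b" "b - x" for x] J_diff[of "a - x" "a - b" for x] by (auto simp: coset_alt)
qed

lemma coset_self: "a \<in> coset J a"
  by (simp add: coset_alt J_0)

lemma coset_add_coset: "coset_add J (coset J a) (coset J b) = coset J (a + b)"
proof -
  have "coset J (s + t) = coset J (a + b)" if "s \<in> coset J a" "t \<in> coset J b" for s t
  proof -
    have "(a - s) + (b - t) \<in> J" using that by (intro J_add) (auto simp: coset_alt)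
    then have "coset J (a + b) = coset J (s + t)" unfolding coset_eq_iff by (simp add: algebra_simps)
    then show ?thesis by simp
  qed
  then show ?thesis
    unfolding coset_add_def using coset_self by (intro coset_UN) blast+
qed

lemma left_act_coset:
  assumes "\<And>x. x \<in> J \<Longrightarrow> c * x \<in> J"
  shows "left_act J c (coset J a) = coset J (c * a)"
proof -
  have "coset J (c * s) = coset J (c * a)" if "s \<in> coset J a" for s
    using assms[of "a - s"] that coset_eq_iff[of "c * a" "c * s"]
    by (simp add: coset_alt right_diff_distrib)
  then show ?thesis
    unfolding left_act_def using coset_self by (intro coset_UN) blast+
qed

lemma right_act_coset:
  assumes "\<And>x. x \<in> J \<Longrightarrow> x * c \<in> J"
  shows "right_act J (coset J a) c = coset J (a * c)"
proof -
  have "coset J (s * c) = coset J (a * c)" if "s \<in> coset J a" for s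
    using assms[of "a - s"] that coset_eq_iff[of "a * c" "s * c"]
    by (simp add: coset_alt left_diff_distrib)
  then show ?thesis
    unfolding right_act_def using coset_self by (intro coset_UN) blast+
qed

end

lemma verma_coset_eq_iff:
  "coset (verma_ideal L lam) a = coset (verma_ideal L lam) b \<longleftrightarrow> a - b \<in> verma_ideal L lam"
  by (simp add: coset_eq_iff verma_idealD)

lemma verma_coset_add:
  "coset_add (verma_ideal L lam) (coset (verma_ideal L lam) a) (coset (verma_ideal L lam) b)
    = coset (verma_ideal L lam) (a + b)"
  by (simp add: coset_add_coset verma_idealD)

lemma verma_act:
  "left_act (verma_ideal L lam) c (coset (verma_ideal L lam) a) = coset (verma_ideal L lam) (c * a)"
  by (simp add: left_act_coset verma_idealD)

lemma dual_verma_coset_eq_iff: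
  "coset (dual_verma_ideal L lam) a = coset (dual_verma_ideal L lam) b
    \<longleftrightarrow> a - b \<in> dual_verma_ideal L lam"
  by (simp add: coset_eq_iff dual_verma_idealD)

lemma dual_verma_act:
  "right_act (dual_verma_ideal L lam) (coset (dual_verma_ideal L lam) a) c
    = coset (dual_verma_ideal L lam) (a * c)"
  by (simp add: right_act_coset dual_verma_idealD)

lemma verma_eq: "verma L lam = range (coset (verma_ideal L lam))"
  by (auto simp: verma_def quotient_def coset_def)

lemma dual_verma_eq: "dual_verma L lam = range (coset (dual_verma_ideal L lam))"
  by (auto simp: dual_verma_def quotient_def coset_def)

section \<open>The Verma module and its dual as highest weight modules\<close>

context simple_lie_algebra
begin

lemma gen_eq_bracket: "bracket L x y = scale L c z \<Longrightarrow>
    gen x * gen y - gen y * gen x - const c * gen z \<in> enveloping_ideal L"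
  using enveloping_idealD(2)[OF gen_bracket[of x y] gen_scale[of L c z]] by simp

lemma gen_h_h:
  "gen (chev_h L i) * gen (chev_h L j) - gen (chev_h L j) * gen (chev_h L i) \<in> enveloping_ideal L"
  using gen_eq_bracket[of "chev_h L i" "chev_h L j" 0 0] by (simp add: bracket_h_h)

lemma gen_h_e: "gen (chev_h L i) * gen (chev_e L j) - gen (chev_e L j) * gen (chev_h L i)
    - const (simple_root L j $ i) * gen (chev_e L j) \<in> enveloping_ideal L"
  using gen_eq_bracket[OF bracket_h_e[of i j]] by (simp add: simple_root_def)

lemma gen_h_f: "gen (chev_h L i) * gen (chev_f L j) - gen (chev_f L j) * gen (chev_h L i)
    + const (simple_root L j $ i) * gen (chev_f L j) \<in> enveloping_ideal L"
  using gen_eq_bracket[OF bracket_h_f[of i j]] by (simp add: simple_root_def const_uminus)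

lemma gen_e_f: "gen (chev_e L i) * gen (chev_f L j) - gen (chev_f L j) * gen (chev_e L i)
    - (if i = j then gen (chev_h L j) else 0) \<in> enveloping_ideal L"
  using gen_eq_bracket[of "chev_e L i" "chev_f L j" "if i = j then 1 else 0" "chev_h L j"]
  by (auto simp: bracket_e_f)

lemma gen_e_verma: "gen (chev_e L i) \<in> verma_ideal L lam"
  unfolding verma_ideal_def nilp_pos_def by (rule hull_inc) (blast intro: hull_inc)

lemma gen_h_verma: "gen (chev_h L i) - const (lam $ i) \<in> verma_ideal L lam"
  unfolding verma_ideal_def by (rule hull_inc) blast

lemma gen_f_dual_verma: "gen (chev_f L i) \<in> dual_verma_ideal L lam"
  unfolding dual_verma_ideal_def nilp_neg_def by (rule hull_inc) (blast intro: hull_inc)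

lemma gen_h_dual_verma: "gen (chev_h L i) - const (lam $ i) \<in> dual_verma_ideal L lam"
  unfolding dual_verma_ideal_def by (rule hull_inc) blast

text \<open>A relation in the two-sided enveloping ideal can be multiplied by a vector on either
  side. The premise \<open>a * x = b\<close> leaves the rearrangement of the goal to the
  simplifier.\<close>

lemma enveloping_verma_mult:
  "a \<in> enveloping_ideal L \<Longrightarrow> a * x = b \<Longrightarrow> b \<in> verma_ideal L lam"
  using enveloping_ideal_le_verma_ideal enveloping_idealD(6) by blast

lemma enveloping_dual_verma_mult:
  "a \<in> enveloping_ideal L \<Longrightarrow> x * a = b \<Longrightarrow> b \<in> dual_verma_ideal L lam"
  using enveloping_ideal_le_dual_verma_ideal enveloping_idealD(3) by blast

lemma highest_weight_module_verma:
  "highest_weight_module (\<lambda>c x. const c * x) (verma_ideal L lam) (\<lambda>i x. gen (chev_e L i) * x)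
     (\<lambda>i x. gen (chev_f L i) * x) (\<lambda>i x. gen (chev_h L i) * x) (simple_root L) lam 1"
proof -
  interpret V: vector_space "\<lambda>c x. const c * x" by (rule vector_space_const)
  show ?thesis
  proof
    show "V.subspace (verma_ideal L lam)" by (rule V.subspaceI) (simp_all add: verma_idealD)
    show "gen (chev_h L i) * (gen (chev_h L j) * x) - gen (chev_h L j) * (gen (chev_h L i) * x)
      \<in> verma_ideal L lam" for i j x
      by (rule enveloping_verma_mult[OF gen_h_h[of i j], of x]) (simp add: algebra_simps)
    show "gen (chev_h L i) * (gen (chev_e L j) * x) - (gen (chev_e L j) * (gen (chev_h L i) * x)
      + const (simple_root L j $ i) * (gen (chev_e L j) * x)) \<in> verma_ideal L lam" for i j x
      by (rule enveloping_verma_mult[OF gen_h_e[of i j], of x]) (simp add: algebra_simps)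
    show "gen (chev_h L i) * (gen (chev_f L j) * x) - (gen (chev_f L j) * (gen (chev_h L i) * x)
      - const (simple_root L j $ i) * (gen (chev_f L j) * x)) \<in> verma_ideal L lam" for i j x
      by (rule enveloping_verma_mult[OF gen_h_f[of i j], of x]) (simp add: algebra_simps)
    show "gen (chev_e L i) * (gen (chev_f L j) * x) - (gen (chev_f L j) * (gen (chev_e L i) * x)
      + (if i = j then gen (chev_h L i) * x else 0)) \<in> verma_ideal L lam" for i j x
      by (rule enveloping_verma_mult[OF gen_e_f[of i j], of x]) (auto simp: algebra_simps)
  qed (simp_all add: verma_idealD gen_e_verma gen_h_verma distrib_left const_left_commute)
qed

text \<open>Right multiplication reverses products and hence the sign of commutators. Exchanging the
  roles of e and f compensates for this, so all relations take the same form as in the Verma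
  module.\<close>

lemma highest_weight_module_dual_verma:
  "highest_weight_module (\<lambda>c x. const c * x) (dual_verma_ideal L lam) (\<lambda>i x. x * gen (chev_f L i))
     (\<lambda>i x. x * gen (chev_e L i)) (\<lambda>i x. x * gen (chev_h L i)) (simple_root L) lam 1"
proof -
  interpret V: vector_space "\<lambda>c x. const c * x" by (rule vector_space_const)
  show ?thesis
  proof
    show "V.subspace (dual_verma_ideal L lam)"
      by (rule V.subspaceI) (auto simp: dual_verma_idealD simp flip: const_commute)
    show "x * gen (chev_h L j) * gen (chev_h L i) - x * gen (chev_h L i) * gen (chev_h L j)
      \<in> dual_verma_ideal L lam" for i j x
      by (rule enveloping_dual_verma_mult[OF gen_h_h[of j i], of x]) (simp add: algebra_simps)
    show "x * gen (chev_f L j) * gen (chev_h L i) - (x * gen (chev_h L i) * gen (chev_f L j)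
      + const (simple_root L j $ i) * (x * gen (chev_f L j))) \<in> dual_verma_ideal L lam" for i j x
      by (rule enveloping_dual_verma_mult[OF enveloping_idealD(4)[OF gen_h_f[of i j]], of x])
        (simp add: algebra_simps const_left_commute)
    show "x * gen (chev_e L j) * gen (chev_h L i) - (x * gen (chev_h L i) * gen (chev_e L j)
      - const (simple_root L j $ i) * (x * gen (chev_e L j))) \<in> dual_verma_ideal L lam" for i j x
      by (rule enveloping_dual_verma_mult[OF enveloping_idealD(4)[OF gen_h_e[of i j]], of x])
        (simp add: algebra_simps const_left_commute)
    show "x * gen (chev_e L j) * gen (chev_f L i) - (x * gen (chev_f L i) * gen (chev_e L j)
      + (if i = j then x * gen (chev_h L i) else 0)) \<in> dual_verma_ideal L lam" for i j x
      by (rule enveloping_dual_verma_mult[OF gen_e_f[of j i], of x]) (auto simp: algebra_simps)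
  qed (simp_all add: dual_verma_idealD gen_f_dual_verma gen_h_dual_verma distrib_right mult.assoc)
qed


text \<open>Half the difference of the Casimir eigenvalue on a highest weight vector of weight \<open>lam\<close> and
  the one on a vector of weight \<open>lam - root_comb L n\<close> that is killed by all \<open>e\<^sub>i\<close>.\<close>

definition casimir_gap :: "complex ^ 'i \<Rightarrow> ('i \<Rightarrow> nat) \<Rightarrow> complex" where
  "casimir_gap lam n = form L (lam + weyl_vector) (root_comb L n)
     - 1/2 * form L (root_comb L n) (root_comb L n)"

section \<open>The bilinear form and the increments of the Casimir gap\<close>

lemma form_add_right: "form L \<kappa> (a + b) = form L \<kappa> a + form L \<kappa> b"
  and form_scale_right: "form L \<kappa> (c *s a) = c * form L \<kappa> a"
  using form_linear[of \<kappa>] by (simp_all add: Vector_Spaces.linear_iff)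

lemma form_add_left: "form L (a + b) \<kappa> = form L a \<kappa> + form L b \<kappa>"
  and form_scale_left: "form L (c *s a) \<kappa> = c * form L a \<kappa>"
  by (simp_all add: form_sym[of _ \<kappa>] form_add_right form_scale_right)

lemma form_0_right [simp]: "form L \<kappa> 0 = 0"
  using form_scale_right[of \<kappa> 0 0] by simp

lemma form_sum_right: "form L \<kappa> (sum f S) = (\<Sum>i\<in>S. form L \<kappa> (f i))"
  by (induction S rule: infinite_finite_induct) (auto simp: form_add_right)

lemma form_sum_left: "form L (sum f S) \<kappa> = (\<Sum>i\<in>S. form L (f i) \<kappa>)"
  by (simp add: form_sym[of _ \<kappa>] form_sum_right)

lemma form_diff_right: "form L \<kappa> (a - b) = form L \<kappa> a - form L \<kappa> b"
  using form_add_right[of \<kappa> "a - b" b] by simp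

lemma form_diff_left: "form L (a - b) \<kappa> = form L a \<kappa> - form L b \<kappa>"
  by (simp add: form_sym[of _ \<kappa>] form_diff_right)

text \<open>For a simple root \<kappa> this is \<open>form_root_coroot\<close> together with alpha_j
  being d_j times its co-root; it extends linearly because the simple roots span. This is the origin
  of the factors d_j.\<close>

lemma form_simple_root: "form L \<kappa> (simple_root L j) = of_nat (symmetrizer L j) * \<kappa> $ j"
proof -
  have "simple_root L j = of_nat (symmetrizer L j) *s simple_coroot L j"
    using symmetrizer_pos[of j] by (simp add: simple_coroot_def)
  then have root: "form L (simple_root L i) (simple_root L j)
      = of_nat (symmetrizer L j) * simple_root L i $ j" for i
    by (simp add: form_scale_right form_root_coroot) (simp add: simple_root_def)
  obtain x where "\<kappa> = (\<Sum>i\<in>UNIV. x i *s simple_root L i)" using simple_roots_span by blast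
  then show ?thesis
    by (simp add: form_sum_left form_scale_left root sum_component sum_distrib_left mult_ac)
qed

lemma root_comb_0: "root_comb L (\<lambda>_. 0) = 0"
  by (simp add: root_comb_def)

lemma casimir_gap_0: "casimir_gap lam (\<lambda>_. 0) = 0"
  by (simp add: casimir_gap_def root_comb_0)

interpretation L0: highest_weight_module "\<lambda>c x. const c * x" "verma_ideal L lam"
  "\<lambda>i x. gen (chev_e L i) * x" "\<lambda>i x. gen (chev_f L i) * x" "\<lambda>i x. gen (chev_h L i) * x"
  "simple_root L" lam 1 for lam
  by (rule highest_weight_module_verma)

lemma root_comb_incr: "root_comb L (incr j n) = root_comb L n + simple_root L j"
  using L0.root_sum_incr unfolding L0.root_sum_def root_comb_def .

text \<open>The pairing of rho with alpha_j is d_j, which equals half of (alpha_j|alpha_j). The two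
  cancel, and only (lam - beta|alpha_j) is left.\<close>

lemma casimir_gap_incr:
  "casimir_gap lam (incr j n)
    = casimir_gap lam n + of_nat (symmetrizer L j) * (lam - root_comb L n) $ j"
proof -
  have "simple_root L j $ j = 2" "weyl_vector $ j = (1 :: complex)"
    by (simp_all add: simple_root_def cartan_diag weyl_vector_def fund_weight_def sum_component axis_def)
  then show ?thesis
    by (simp add: casimir_gap_def root_comb_incr form_add_left form_add_right form_simple_root
        form_sym[of "simple_root L j" "root_comb L n"] algebra_simps)
qed

lemma form_shift:
  "1/2 * form L (lam + weyl_vector - root_comb L n) (lam + weyl_vector - root_comb L n)
   = 1/2 * form L (lam + weyl_vector) (lam + weyl_vector) - casimir_gap lam n"
  unfolding casimir_gap_def form_diff_left form_diff_right
    form_sym[of "root_comb L n" "lam + weyl_vector"]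
  by (simp add: algebra_simps)

end

section \<open>Irreducible Verma modules\<close>

locale generic_weight = simple_lie_algebra L
  for L :: "('g::ab_group_add, 'i::finite) chevalley_data" +
  fixes lam :: "complex ^ 'i"
  assumes generic: "generic L lam"
begin

sublocale left: highest_weight_module "\<lambda>c x. const c * x" "verma_ideal L lam"
  "\<lambda>i x. gen (chev_e L i) * x" "\<lambda>i x. gen (chev_f L i) * x" "\<lambda>i x. gen (chev_h L i) * x"
  "simple_root L" lam 1
  by (rule highest_weight_module_verma)

sublocale right: highest_weight_module "\<lambda>c x. const c * x" "dual_verma_ideal L lam"
  "\<lambda>i x. x * gen (chev_f L i)" "\<lambda>i x. x * gen (chev_e L i)" "\<lambda>i x. x * gen (chev_h L i)"
  "simple_root L" lam 1
  by (rule highest_weight_module_dual_verma)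

lemma root_sum_left: "left.root_sum = root_comb L" and root_sum_right: "right.root_sum = root_comb L"
  by (simp_all add: fun_eq_iff left.root_sum_def right.root_sum_def root_comb_def)

lemma casimir_gap_nonzero: "n \<noteq> (\<lambda>_. 0) \<Longrightarrow> casimir_gap lam n \<noteq> 0"
  using generic by (simp add: generic_def casimir_gap_def)

text \<open>Otherwise the quotient would be zero, which \<open>verma_irreducible\<close> excludes.
  The contradictions obtained further on all end here.\<close>

lemma one_notin_verma_ideal: "1 \<notin> verma_ideal L lam"
proof
  assume "1 \<in> verma_ideal L lam"
  then have "x \<in> verma_ideal L lam" for x using verma_idealD(3)[of 1 L lam x] by simp
  then have "coset (verma_ideal L lam) x = coset (verma_ideal L lam) 0" for x
    by (simp add: verma_coset_eq_iff)
  then have "verma L lam = {coset (verma_ideal L lam) 0}" unfolding verma_eq by blast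
  with generic show False by (simp add: generic_def verma_irreducible_def)
qed

lemma const_in_verma_ideal: "const c \<in> verma_ideal L lam \<Longrightarrow> c = 0"
  using verma_idealD(3)[of "const c" L lam "const (1 / c)"] one_notin_verma_ideal
  by (cases "c = 0") (auto simp flip: const_mult)

text \<open>The map \<open>gen\<close> is linear only modulo the enveloping ideal, so
  \<open>M\<close> has to contain the Verma ideal. The set \<open>M'\<close> is \<open>M\<close> for
  stability statements, and \<open>UNIV\<close> for elements that send every vector into
  \<open>M\<close>.\<close>

lemma subspace_gen_stable:
  assumes "\<And>y. y \<in> verma_ideal L lam \<Longrightarrow> y \<in> M" "\<And>y z. y \<in> M \<Longrightarrow> z \<in> M \<Longrightarrow> y + z \<in> M"
    "\<And>c y. y \<in> M \<Longrightarrow> const c * y \<in> M"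
  shows "subspace {g. \<forall>y\<in>M'. gen g * y \<in> M}"
proof (rule subspaceI)
  show "0 \<in> {g. \<forall>y\<in>M'. gen g * y \<in> M}"
    using assms(1) enveloping_verma_mult[OF gen_0 refl] by blast
next
  fix g h assume *: "g \<in> {g. \<forall>y\<in>M'. gen g * y \<in> M}" "h \<in> {g. \<forall>y\<in>M'. gen g * y \<in> M}"
  have "gen (g + h) * y \<in> M" if "y \<in> M'" for y
  proof -
    have "(gen (g + h) - gen g - gen h) * y + (gen g * y + gen h * y) \<in> M"
      using * that by (intro assms(2)[OF assms(1)[OF enveloping_verma_mult[OF gen_add refl]] assms(2)]) auto
    then show ?thesis by (simp add: algebra_simps)
  qed
  then show "g + h \<in> {g. \<forall>y\<in>M'. gen g * y \<in> M}" by blast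
next
  fix c g assume *: "g \<in> {g. \<forall>y\<in>M'. gen g * y \<in> M}"
  have "gen (scale L c g) * y \<in> M" if "y \<in> M'" for y
  proof -
    have "(gen (scale L c g) - const c * gen g) * y + const c * (gen g * y) \<in> M"
      using * that by (intro assms(2)[OF assms(1)[OF enveloping_verma_mult[OF gen_scale refl]] assms(3)]) auto
    then show ?thesis by (simp add: algebra_simps)
  qed
  then show "scale L c g \<in> {g. \<forall>y\<in>M'. gen g * y \<in> M}" by blast
qed

lemma gen_bracket_mult:
  assumes "\<And>y. y \<in> verma_ideal L lam \<Longrightarrow> y \<in> M" "\<And>y z. y \<in> M \<Longrightarrow> z \<in> M \<Longrightarrow> y + z \<in> M"
    "\<And>c y. y \<in> M \<Longrightarrow> const c * y \<in> M"
    and "gen g * (gen h * y) \<in> M" "gen h * (gen g * y) \<in> M"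
  shows "gen (bracket L g h) * y \<in> M"
proof -
  have "const (-1) * ((gen g * gen h - gen h * gen g - gen (bracket L g h)) * y)
      + (gen g * (gen h * y) + const (-1) * (gen h * (gen g * y))) \<in> M"
    using assms(4,5)
    by (intro assms(2)[OF assms(3)[OF assms(1)[OF enveloping_verma_mult[OF gen_bracket refl]]]
          assms(2)[OF _ assms(3)]]) auto
  then show ?thesis by (simp add: const_uminus algebra_simps)
qed

text \<open>The elements preserving the span form a subalgebra that contains the Chevalley
  generators, hence all of the Lie algebra; products follow by induction on \<open>a\<close>. So the
  span is the submodule generated by the singular vector.\<close>

lemma F_span_stable:
  assumes "left.weight_vector \<kappa> x" "\<And>j. gen (chev_e L j) * x \<in> verma_ideal L lam"
    and y: "y \<in> left.F_span UNIV x"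
  shows "a * y \<in> left.F_span UNIV x"
proof -
  let ?M = "left.F_span UNIV x"
  note M = left.F_span_J left.F_span_add left.F_span_scale
  have "subalgebra {g. \<forall>y\<in>?M. gen g * y \<in> ?M}"
    unfolding subalgebra_def
  proof (intro conjI ballI)
    show "subspace {g. \<forall>y\<in>?M. gen g * y \<in> ?M}" by (rule subspace_gen_stable[OF M])
    fix g h assume "g \<in> {g. \<forall>y\<in>?M. gen g * y \<in> ?M}" "h \<in> {g. \<forall>y\<in>?M. gen g * y \<in> ?M}"
    then show "bracket L g h \<in> {g. \<forall>y\<in>?M. gen g * y \<in> ?M}"
      using gen_bracket_mult[OF M] by blast
  qed
  then have "{g. \<forall>y\<in>?M. gen g * y \<in> ?M} = UNIV"
    by (rule subalgebra_generated)
      (auto intro: left.F_span_F left.F_span_H[OF _ assms(1)] left.F_span_E[OF _ assms(1,2)])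
  then have *: "gen g * y \<in> ?M" if "y \<in> ?M" for g y using that by blast
  show ?thesis
  proof (induction a rule: free_algebra_induct)
    case (const c)
    show ?case by (rule left.F_span_scale[OF y])
  next
    case (gen g x)
    then show ?case unfolding mult.assoc by (rule *)
  next
    case (add a b)
    then show ?case unfolding distrib_right by (rule left.F_span_add)
  qed
qed

lemma one_in_F_span: "1 \<in> left.F_span UNIV 1"
  using left.F_span_word[of "[]" UNIV 1 1] by simp

text \<open>This is V = U(n_-)|lam>, read off from \<open>x = x * 1\<close>.\<close>

lemma F_span_UNIV: "x \<in> left.F_span UNIV 1"
  using F_span_stable[OF left.weight_vector_v0 _ one_in_F_span, of x] by (simp add: gen_e_verma)

lemma word_weight_eq_root_comb: "left.word_weight is = root_comb L (count_list is)"
  using left.word_weight_eq_root_sum by (simp add: root_sum_left)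

text \<open>Nonempty words have weight different from \<open>lam\<close>, so no nonzero constant lies in
  \<open>verma_ideal + dual_verma_ideal\<close>: this makes \<open>vev\<close> well defined.\<close>

lemma dual_verma_ideal_F_span:
  assumes "x \<in> dual_verma_ideal L lam"
  shows "x \<in> left.F_span {is. is \<noteq> []} 1"
proof -
  let ?M = "left.F_span {is. is \<noteq> []} 1"
  note M = left.F_span_J left.F_span_add left.F_span_scale
  have "subalgebra {g. \<forall>y\<in>UNIV. gen g * y \<in> ?M}"
    unfolding subalgebra_def
  proof (intro conjI ballI)
    show "subspace {g. \<forall>y\<in>UNIV. gen g * y \<in> ?M}" by (rule subspace_gen_stable[OF M])
    fix g h assume "g \<in> {g. \<forall>y\<in>UNIV. gen g * y \<in> ?M}" "h \<in> {g. \<forall>y\<in>UNIV. gen g * y \<in> ?M}"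
    then show "bracket L g h \<in> {g. \<forall>y\<in>UNIV. gen g * y \<in> ?M}"
      using gen_bracket_mult[OF M] by blast
  qed
  moreover have "gen (chev_f L i) * y \<in> ?M" for i y
    by (rule left.F_span_F[OF F_span_UNIV]) simp
  then have "range (chev_f L) \<subseteq> {g. \<forall>y\<in>UNIV. gen g * y \<in> ?M}" by auto
  ultimately have neg: "nilp_neg L \<subseteq> {g. \<forall>y\<in>UNIV. gen g * y \<in> ?M}"
    unfolding nilp_neg_def by (simp add: hull_minimal)
  \<comment> \<open>Quantifying over all right factors \<open>a\<close> turns the membership
    condition into a right ideal; \<open>a = 1\<close> recovers the claim.\<close>
  have "dual_verma_ideal L lam \<subseteq> {x. \<forall>a. x * a \<in> ?M}"
    unfolding dual_verma_ideal_def
  proof (rule hull_minimal)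
    show "right_ideal {x. \<forall>a. x * a \<in> ?M}"
      unfolding right_ideal_def
      by (auto simp: distrib_right mult.assoc left.F_span_add left.F_span_J[OF verma_idealD(1)])
    have "x * a \<in> ?M" if "x \<in> enveloping_ideal L" for x a
      by (rule left.F_span_J[OF enveloping_verma_mult[OF that refl]])
    moreover have "(gen (chev_h L i) - const (lam $ i)) * a \<in> ?M" for i a
      using left.F_span_H_diff[OF F_span_UNIV left.weight_vector_v0] by (simp add: left_diff_distrib)
    ultimately show "enveloping_ideal L \<union> gen ` nilp_neg L
        \<union> range (\<lambda>i. gen (chev_h L i) - const (lam $ i)) \<subseteq> {x. \<forall>a. x * a \<in> ?M}"
      using neg by auto
  qed
  then have "x * 1 \<in> ?M" using assms by blast
  then show ?thesis by simp
qed

lemma root_comb_eq_0_iff: "root_comb L n = 0 \<longleftrightarrow> n = (\<lambda>_. 0)"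
  using root_comb_inj[of n "\<lambda>_. 0"] by (simp add: root_comb_0)

lemma count_list_eq_0_iff: "count_list is = (\<lambda>_. 0) \<longleftrightarrow> is = []"
  by (auto simp: fun_eq_iff count_list_0_iff)

lemma dual_verma_ideal_off_weight:
  "x \<in> dual_verma_ideal L lam \<Longrightarrow> x \<in> left.off_weight lam"
  by (rule left.F_span_off_weight[OF dual_verma_ideal_F_span left.weight_vector_v0])
    (auto simp: word_weight_eq_root_comb root_comb_eq_0_iff count_list_eq_0_iff)

section \<open>The vacuum expectation value and the pairing\<close>

lemma weight_vector_const: "left.weight_vector lam (const c)"
  using left.weight_vector_scale[OF left.weight_vector_v0, of c] by simp

definition vev_rel :: "'g free_algebra \<Rightarrow> complex \<Rightarrow> bool" where
  "vev_rel x c \<longleftrightarrow> (\<exists>l\<in>verma_ideal L lam. \<exists>r\<in>dual_verma_ideal L lam. x = const c + l + r)"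

text \<open>The constant has weight \<open>lam\<close> but equals \<open>- r - l\<close>, which lies
  in \<open>off_weight lam\<close>. Hence it is in the Verma ideal and must be zero.\<close>

lemma vev_rel_0:
  assumes "vev_rel 0 c"
  shows "c = 0"
proof -
  obtain l r where lr: "l \<in> verma_ideal L lam" "r \<in> dual_verma_ideal L lam" "0 = const c + l + r"
    using assms by (auto simp: vev_rel_def)
  have "const c = - r - l"
    using lr(3)[symmetric] by (simp add: eq_diff_eq eq_neg_iff_add_eq_0)
  moreover have "- r - l \<in> left.off_weight lam"
    using left.off_weight_J_add[OF left.off_weight_scale[OF dual_verma_ideal_off_weight[OF lr(2)], of "-1"]
        verma_idealD(4)[OF lr(1)]] by (simp add: const_uminus)
  ultimately have "const c \<in> verma_ideal L lam"
    using left.off_weight_imp_J weight_vector_const by metis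
  then show ?thesis by (rule const_in_verma_ideal)
qed

lemma vev_rel_add: "vev_rel x c \<Longrightarrow> vev_rel y d \<Longrightarrow> vev_rel (x + y) (c + d)"
proof -
  assume "vev_rel x c" "vev_rel y d"
  then obtain l r l' r' where "l \<in> verma_ideal L lam" "r \<in> dual_verma_ideal L lam" "x = const c + l + r"
    "l' \<in> verma_ideal L lam" "r' \<in> dual_verma_ideal L lam" "y = const d + l' + r'"
    by (auto simp: vev_rel_def)
  then show ?thesis
    unfolding vev_rel_def
    by (intro bexI[of _ "l + l'"] bexI[of _ "r + r'"])
      (auto simp: const_add algebra_simps verma_idealD dual_verma_idealD)
qed

lemma vev_rel_scale: "vev_rel x c \<Longrightarrow> vev_rel (const a * x) (a * c)"
proof -
  assume "vev_rel x c"
  then obtain l r where "l \<in> verma_ideal L lam" "r \<in> dual_verma_ideal L lam" "x = const c + l + r"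
    by (auto simp: vev_rel_def)
  moreover have "const a * r \<in> dual_verma_ideal L lam"
    using calculation dual_verma_idealD(3)[of r L lam "const a"] by (simp add: const_commute)
  ultimately show ?thesis
    unfolding vev_rel_def
    by (intro bexI[of _ "const a * l"] bexI[of _ "const a * r"])
      (auto simp: const_mult distrib_left verma_idealD)
qed

lemma vev_rel_unique: "vev_rel x c \<Longrightarrow> vev_rel x d \<Longrightarrow> c = d"
  using vev_rel_0[of "c + -1 * d"] vev_rel_add[OF _ vev_rel_scale[of x d "-1"], of x c]
  by (simp add: const_uminus)

lemma vev_rel_verma: "x \<in> verma_ideal L lam \<Longrightarrow> vev_rel x 0"
  unfolding vev_rel_def by (intro bexI[of _ x] bexI[of _ 0]) (auto simp: dual_verma_idealD)

lemma vev_rel_dual_verma: "x \<in> dual_verma_ideal L lam \<Longrightarrow> vev_rel x 0"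
  unfolding vev_rel_def by (intro bexI[of _ x] bexI[of _ 0]) (auto simp: verma_idealD)

lemma vev_rel_const: "vev_rel (const c) c"
  unfolding vev_rel_def by (intro bexI[of _ 0]) (auto simp: verma_idealD dual_verma_idealD)

text \<open>Expand \<open>x\<close> into words modulo the Verma ideal. The empty word gives a
  constant; any other word begins with some f_i and therefore lies in the dual ideal.\<close>

lemma vev_rel_exists: "\<exists>c. vev_rel x c"
  using F_span_UNIV[of x]
proof (induction rule: left.F_span.induct)
  case (F_span_word "is" c)
  show ?case
  proof (cases "is")
    case Nil
    then show ?thesis using vev_rel_const[of c] by auto
  next
    case (Cons i js)
    have "const c * (gen (chev_f L i) * y) \<in> dual_verma_ideal L lam" for y
      using dual_verma_idealD(3)[OF gen_f_dual_verma[of i lam], of "const c * y"]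
      by (metis const_commute mult.assoc)
    with Cons show ?thesis using vev_rel_dual_verma by auto
  qed
next
  case (F_span_J y)
  then show ?case using vev_rel_verma by blast
next
  case (F_span_add y z)
  then show ?case using vev_rel_add by blast
qed

lemma vev_eqI: "vev_rel x c \<Longrightarrow> vev L lam x = c"
  unfolding vev_def vev_rel_def[symmetric] by (rule the_equality) (auto intro: vev_rel_unique)

lemma vev_rel_vev: "vev_rel x (vev L lam x)"
  using vev_rel_exists vev_eqI by metis

lemma vev_add: "vev L lam (x + y) = vev L lam x + vev L lam y"
  by (intro vev_eqI vev_rel_add vev_rel_vev)

lemma vev_scale: "vev L lam (const c * x) = c * vev L lam x"
  by (intro vev_eqI vev_rel_scale vev_rel_vev)

lemma vev_0 [simp]: "vev L lam 0 = 0"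
  using vev_scale[of 0 0] by simp

lemma vev_sum: "vev L lam (sum f S) = (\<Sum>i\<in>S. vev L lam (f i))"
  by (induction S rule: infinite_finite_induct) (auto simp: vev_add)

lemma vev_verma_cong: "x - y \<in> verma_ideal L lam \<Longrightarrow> vev L lam x = vev L lam y"
  using vev_add[of "x - y" y] vev_eqI[OF vev_rel_verma] by simp

lemma vev_dual_verma_cong: "x - y \<in> dual_verma_ideal L lam \<Longrightarrow> vev L lam x = vev L lam y"
  using vev_add[of "x - y" y] vev_eqI[OF vev_rel_dual_verma] by simp

lemma pairing_coset:
  "pairing L lam (coset (dual_verma_ideal L lam) a) (coset (verma_ideal L lam) b) = vev L lam (a * b)"
proof -
  let ?A = "coset (dual_verma_ideal L lam) a" and ?B = "coset (verma_ideal L lam) b"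
  have "vev L lam (a' * b') = vev L lam (a * b)" if "a' \<in> ?A" "b' \<in> ?B" for a' b'
  proof -
    have "vev L lam (a * b) = vev L lam (a' * b)"
      using that dual_verma_idealD(3)[of "a - a'" L lam b]
      by (intro vev_dual_verma_cong) (simp add: coset_alt left_diff_distrib)
    also have "\<dots> = vev L lam (a' * b')"
      using that verma_idealD(3)[of "b - b'" L lam a']
      by (intro vev_verma_cong) (simp add: coset_alt right_diff_distrib)
    finally show ?thesis by simp
  qed
  then have "(\<lambda>(a, b). vev L lam (a * b)) ` (?A \<times> ?B) = (\<lambda>_. vev L lam (a * b)) ` (?A \<times> ?B)"
    by (intro image_cong refl) (simp only: mem_Times_iff split_beta)
  also have "\<dots> = {vev L lam (a * b)}"
    by (rule image_constant[of "(a, b)"]) (simp add: coset_alt verma_idealD dual_verma_idealD)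
  finally show ?thesis by (simp only: pairing_def the_elem_eq)
qed

section \<open>Weight spaces and singular vectors\<close>

lemma verma_weight_space_iff:
  "coset (verma_ideal L lam) x \<in> verma_weight_space L lam \<kappa> \<longleftrightarrow> left.weight_vector \<kappa> x"
  by (simp add: verma_weight_space_def verma_eq verma_act verma_coset_eq_iff
      left.weight_vector_def left.eqv_def rangeI)

lemma dual_verma_weight_space_iff:
  "coset (dual_verma_ideal L lam) x \<in> dual_verma_weight_space L lam \<kappa> \<longleftrightarrow> right.weight_vector \<kappa> x"
  by (simp add: dual_verma_weight_space_def dual_verma_eq dual_verma_act dual_verma_coset_eq_iff
      right.weight_vector_def right.eqv_def const_commute rangeI)

lemma root_comb_add: "root_comb L n + root_comb L m = root_comb L (\<lambda>i. n i + m i)"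
  by (simp add: root_comb_def vec.scale_left_distrib sum.distrib)

text \<open>The words applied to \<open>x\<close> form a submodule whose weights all lie strictly
  below \<open>lam\<close>. It cannot contain the highest weight vector, so irreducibility forces it
  to be zero.\<close>

lemma singular_vector_in_verma_ideal:
  assumes x: "left.weight_vector (lam - root_comb L n) x" and n: "n \<noteq> (\<lambda>_. 0)"
    and e: "\<And>j. gen (chev_e L j) * x \<in> verma_ideal L lam"
  shows "x \<in> verma_ideal L lam"
proof -
  let ?J = "verma_ideal L lam" and ?M = "left.F_span UNIV x"
  have x_M: "x \<in> ?M" using left.F_span_word[of "[]" UNIV 1 x] by simp
  have "verma_submodule L lam (coset ?J ` ?M)"
    unfolding verma_submodule_def
  proof (intro conjI ballI allI)
    show "coset ?J ` ?M \<subseteq> verma L lam" by (auto simp: verma_eq)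
    show "coset ?J 0 \<in> coset ?J ` ?M" by (intro imageI left.F_span_J verma_idealD(1))
    fix S assume "S \<in> coset ?J ` ?M"
    then obtain y where y: "y \<in> ?M" "S = coset ?J y" by blast
    show "left_act ?J a S \<in> coset ?J ` ?M" for a
      unfolding y(2) verma_act by (intro imageI F_span_stable[OF x e y(1)])
    fix T assume "T \<in> coset ?J ` ?M"
    then obtain z where z: "z \<in> ?M" "T = coset ?J z" by blast
    show "coset_add ?J S T \<in> coset ?J ` ?M"
      unfolding y(2) z(2) verma_coset_add by (intro imageI left.F_span_add y(1) z(1))
  qed
  then consider "coset ?J ` ?M = {coset ?J 0}" | "coset ?J ` ?M = verma L lam"
    using generic by (auto simp: generic_def verma_irreducible_def)
  then show ?thesis
  proof cases
    case 1
    then have "coset ?J x = coset ?J 0" using x_M by blast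
    then show ?thesis by (simp add: verma_coset_eq_iff)
  next
    case 2
    then obtain y where "y \<in> ?M" "coset ?J 1 = coset ?J y" unfolding verma_eq by blast
    then have "1 \<in> ?M"
      using left.F_span_eqv by (simp add: verma_coset_eq_iff left.eqv_def)
    moreover have "lam - root_comb L n - left.word_weight is \<noteq> lam" for "is"
    proof
      assume "lam - root_comb L n - left.word_weight is = lam"
      then have "root_comb L (\<lambda>i. n i + count_list is i) = 0"
        by (simp add: word_weight_eq_root_comb diff_diff_eq root_comb_add)
      with n show False by (auto simp: root_comb_eq_0_iff fun_eq_iff)
    qed
    ultimately have "1 \<in> left.off_weight lam"
      using left.F_span_off_weight[OF _ x] by blast
    then have "1 \<in> ?J" by (rule left.off_weight_imp_J[OF _ left.weight_vector_v0])
    with one_notin_verma_ideal show ?thesis by blast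
  qed
qed

end

section \<open>Whittaker vectors and the Toda equation\<close>

locale whittaker_pair = generic_weight L lam
  for L :: "('g::ab_group_add, 'i::finite) chevalley_data" and lam :: "complex ^ 'i" +
  fixes \<mu> \<mu>' :: "'i \<Rightarrow> complex"
begin

sublocale left_rec: whittaker_recursion "\<lambda>c x. const c * x" "verma_ideal L lam"
  "\<lambda>i x. gen (chev_e L i) * x" "\<lambda>i x. gen (chev_f L i) * x" "\<lambda>i x. gen (chev_h L i) * x"
  "simple_root L" lam 1 "casimir_gap lam" "\<lambda>i. of_nat (symmetrizer L i)" \<mu>
  by unfold_locales
    (use casimir_gap_0 casimir_gap_nonzero casimir_gap_incr in \<open>auto simp: root_sum_left\<close>)

sublocale right_rec: whittaker_recursion "\<lambda>c x. const c * x" "dual_verma_ideal L lam"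
  "\<lambda>i x. x * gen (chev_f L i)" "\<lambda>i x. x * gen (chev_e L i)" "\<lambda>i x. x * gen (chev_h L i)"
  "simple_root L" lam 1 "casimir_gap lam" "\<lambda>i. of_nat (symmetrizer L i)" \<mu>'
  by unfold_locales
    (use casimir_gap_0 casimir_gap_nonzero casimir_gap_incr in \<open>auto simp: root_sum_right\<close>)

lemma whittaker_vectors_iff:
  "(\<lambda>n. coset (verma_ideal L lam) (u n)) \<in> whittaker_vectors L lam \<mu> \<longleftrightarrow>
     (\<forall>n. left.weight_vector (lam - root_comb L n) (u n)) \<and> vev L lam (u (\<lambda>_. 0)) = 1
     \<and> (\<forall>i n. gen (chev_e L i) * u (incr i n) - const (\<mu> i) * u n \<in> verma_ideal L lam)"
  by (simp add: whittaker_vectors_def verma_completion_def verma_weight_space_iff pairing_coset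
      verma_act verma_coset_eq_iff)

lemma dual_whittaker_vectors_iff:
  "(\<lambda>n. coset (dual_verma_ideal L lam) (u n)) \<in> dual_whittaker_vectors L lam \<mu>' \<longleftrightarrow>
     (\<forall>n. right.weight_vector (lam - root_comb L n) (u n)) \<and> vev L lam (u (\<lambda>_. 0)) = 1
     \<and> (\<forall>i n. u (incr i n) * gen (chev_f L i) - const (\<mu>' i) * u n \<in> dual_verma_ideal L lam)"
  by (simp add: dual_whittaker_vectors_def dual_verma_completion_def dual_verma_weight_space_iff
      pairing_coset dual_verma_act dual_verma_coset_eq_iff const_commute)

lemma vev_1: "vev L lam 1 = 1"
  using vev_eqI[OF vev_rel_const[of 1]] by simp

lemma whittaker_in_whittaker_vectors:
  "(\<lambda>n. coset (verma_ideal L lam) (left_rec.whittaker n)) \<in> whittaker_vectors L lam \<mu>"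
  unfolding whittaker_vectors_iff
  using left_rec.weight_vector_whittaker left_rec.E_whittaker[where j = i and n = "incr i n" for i n]
  by (auto simp: left_rec.whittaker_0 vev_1 root_sum_left left.eqv_def)

lemma whittaker_in_dual_whittaker_vectors:
  "(\<lambda>n. coset (dual_verma_ideal L lam) (right_rec.whittaker n)) \<in> dual_whittaker_vectors L lam \<mu>'"
  unfolding dual_whittaker_vectors_iff
  using right_rec.weight_vector_whittaker right_rec.E_whittaker[where j = i and n = "incr i n" for i n]
  by (auto simp: right_rec.whittaker_0 vev_1 root_sum_right right.eqv_def)

lemma whittaker_vector_unique:
  assumes "(\<lambda>n. coset (verma_ideal L lam) (u n)) \<in> whittaker_vectors L lam \<mu>"
  shows "u n - left_rec.whittaker n \<in> verma_ideal L lam"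
proof (induction "\<Sum>i\<in>UNIV. n i" arbitrary: n rule: less_induct)
  case less
  have u: "left.weight_vector (lam - root_comb L n) (u n)" "vev L lam (u (\<lambda>_. 0)) = 1"
    "gen (chev_e L i) * u (incr i n) - const (\<mu> i) * u n \<in> verma_ideal L lam" for i n
    using assms by (auto simp: whittaker_vectors_iff)
  show ?case
  proof (cases "n = (\<lambda>_. 0)")
    case True
    \<comment> \<open>The normalisation only fixes an expectation value, so it leaves a remainder
      \<open>r\<close> in the dual ideal. This remainder has weight \<open>lam\<close> and is also
      in \<open>off_weight lam\<close>, hence vanishes; this plays the part of the
      one-dimensionality of the top weight space.\<close>
    obtain l r where lr: "l \<in> verma_ideal L lam" "r \<in> dual_verma_ideal L lam" "u n = const 1 + l + r"
      using vev_rel_vev[of "u n"] u(2) True by (auto simp: vev_rel_def)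
    then have r: "r = u n - 1 - l" by (simp add: algebra_simps)
    have "left.weight_vector lam (u n - 1)"
      using left.weight_vector_diff[OF u(1)[of n]] left.weight_vector_v0 True by (simp add: root_comb_0)
    then have "left.weight_vector lam r"
      by (rule left.weight_vector_eqv) (simp add: r left.eqv_def lr(1) verma_idealD(4))
    then have "r \<in> verma_ideal L lam"
      using left.off_weight_imp_J[OF dual_verma_ideal_off_weight[OF lr(2)]] by blast
    with lr True show ?thesis by (simp add: left_rec.whittaker_0 verma_idealD(2))
  next
    case False
    show ?thesis
    proof (rule singular_vector_in_verma_ideal[OF _ False])
      show "left.weight_vector (lam - root_comb L n) (u n - left_rec.whittaker n)"
        using left.weight_vector_diff u(1) left_rec.weight_vector_whittaker[of n]
        by (simp add: root_sum_left)
      fix j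
      have E: "left.eqv (gen (chev_e L j) * left_rec.whittaker n)
          (if n j = 0 then 0 else const (\<mu> j) * left_rec.whittaker (decr j n))"
        by (rule left_rec.E_whittaker)
      have "left.eqv (gen (chev_e L j) * u n)
          (if n j = 0 then 0 else const (\<mu> j) * left_rec.whittaker (decr j n))"
      proof (cases "n j = 0")
        case True
        \<comment> \<open>The Whittaker condition only constrains degrees of the form
          \<open>incr j _\<close>, so it says nothing here. The vector vanishes because its weight
          is not in lam - Q_+.\<close>
        have *: "left.weight_vector (lam - root_comb L n + simple_root L j) (gen (chev_e L j) * u n)"
          by (rule left.weight_vector_E[OF u(1)])
        have "gen (chev_e L j) * u n \<in> left.off_weight (lam - root_comb L n + simple_root L j)"
        proof (rule left.F_span_off_weight[OF F_span_UNIV left.weight_vector_v0])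
          fix "is"
          show "lam - left.word_weight is \<noteq> lam - root_comb L n + simple_root L j"
          proof
            assume "lam - left.word_weight is = lam - root_comb L n + simple_root L j"
            then have "root_comb L n = root_comb L (incr j (count_list is))"
              by (simp add: word_weight_eq_root_comb root_comb_incr algebra_simps)
            then have "n j = incr j (count_list is) j" by (simp add: root_comb_inj)
            with True show False by simp
          qed
        qed
        then have "gen (chev_e L j) * u n \<in> verma_ideal L lam"
          using left.off_weight_imp_J * by blast
        with True show ?thesis by (simp add: left.eqv_def)
      next
        case nj: False
        have "left.eqv (gen (chev_e L j) * u n) (const (\<mu> j) * u (decr j n))"
          using u(3)[of j "decr j n"] nj by (simp add: incr_decr left.eqv_def)
        also have "left.eqv (const (\<mu> j) * u (decr j n)) (const (\<mu> j) * left_rec.whittaker (decr j n))"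
          using less[OF sum_decr_less[of n j, OF nj]] by (intro left.eqv_scale) (simp add: left.eqv_def)
        finally show ?thesis using nj by simp
      qed
      from left.eqv_diff[OF this E]
      show "gen (chev_e L j) * (u n - left_rec.whittaker n) \<in> verma_ideal L lam"
        by (simp add: left.eqv_def right_diff_distrib)
    qed
  qed
qed

section \<open>The coefficients of the Whittaker function\<close>

definition coeff :: "('i \<Rightarrow> nat) \<Rightarrow> complex" where
  "coeff n = pairing L lam (dual_whittaker_vector L lam \<mu>' n) (whittaker_vector L lam \<mu> n)"

lemma coeff_recursion:
  "casimir_gap lam n * coeff n
    = (\<Sum>i\<in>UNIV. if n i = 0 then 0 else of_nat (symmetrizer L i) * \<mu> i * \<mu>' i * coeff (decr i n))"
proof -
  \<comment> \<open>The existence of Whittaker vectors on both sides is what gives the two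
    \<open>SOME\<close> choices a meaning.\<close>
  have mem: "whittaker_vector L lam \<mu> \<in> whittaker_vectors L lam \<mu>"
    "dual_whittaker_vector L lam \<mu>' \<in> dual_whittaker_vectors L lam \<mu>'"
    unfolding whittaker_vector_def dual_whittaker_vector_def
    using someI[where P = "\<lambda>w. w \<in> whittaker_vectors L lam \<mu>"] whittaker_in_whittaker_vectors
      someI[where P = "\<lambda>w. w \<in> dual_whittaker_vectors L lam \<mu>'"]
      whittaker_in_dual_whittaker_vectors
    by auto
  have "whittaker_vector L lam \<mu> n \<in> range (coset (verma_ideal L lam))" for n
    using mem(1)
    by (simp add: whittaker_vectors_def verma_completion_def verma_weight_space_def verma_eq)
  moreover have "dual_whittaker_vector L lam \<mu>' n \<in> range (coset (dual_verma_ideal L lam))" for n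
    using mem(2) by (simp add: dual_whittaker_vectors_def dual_verma_completion_def
        dual_verma_weight_space_def dual_verma_eq)
  ultimately have "\<forall>n. \<exists>x. whittaker_vector L lam \<mu> n = coset (verma_ideal L lam) x"
    "\<forall>n. \<exists>x. dual_whittaker_vector L lam \<mu>' n = coset (dual_verma_ideal L lam) x"
    by blast+
  then obtain u v
    where "\<forall>n. whittaker_vector L lam \<mu> n = coset (verma_ideal L lam) (u n)"
      "\<forall>n. dual_whittaker_vector L lam \<mu>' n = coset (dual_verma_ideal L lam) (v n)"
    unfolding choice_iff by blast
  then have uv: "whittaker_vector L lam \<mu> = (\<lambda>n. coset (verma_ideal L lam) (u n))"
    "dual_whittaker_vector L lam \<mu>' = (\<lambda>n. coset (dual_verma_ideal L lam) (v n))"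
    by (simp_all add: fun_eq_iff)
  \<comment> \<open>Uniqueness allows the chosen vector to be replaced by the recursive solution
    inside the pairing. Each f_i in the recursion is then absorbed by \<open>v\<close>, at the price
    of a factor \<mu>'_i.\<close>
  have coeff_uv: "coeff m = vev L lam (v m * left_rec.whittaker m)" for m
  proof -
    have "v m * (u m - left_rec.whittaker m) \<in> verma_ideal L lam"
      using whittaker_vector_unique[of u m] mem(1) by (intro verma_idealD(3)) (simp add: uv)
    then show ?thesis
      unfolding coeff_def uv pairing_coset by (intro vev_verma_cong) (simp add: right_diff_distrib)
  qed
  have v: "v n * gen (chev_f L i) - const (\<mu>' i) * v (decr i n) \<in> dual_verma_ideal L lam"
    if "n i \<noteq> 0" for i
  proof -
    have "v (incr i (decr i n)) * gen (chev_f L i) - const (\<mu>' i) * v (decr i n)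
        \<in> dual_verma_ideal L lam"
      using mem(2) unfolding uv dual_whittaker_vectors_iff by blast
    with that show ?thesis by (simp add: incr_decr)
  qed
  have summand: "vev L lam (v n * (const (of_nat (symmetrizer L i) * \<mu> i)
      * (gen (chev_f L i) * left_rec.whittaker (decr i n))))
      = of_nat (symmetrizer L i) * \<mu> i * \<mu>' i * coeff (decr i n)" if "n i \<noteq> 0" for i
  proof -
    let ?w = "left_rec.whittaker (decr i n)" and ?c = "of_nat (symmetrizer L i) * \<mu> i"
    have "v n * (const ?c * (gen (chev_f L i) * ?w)) = const ?c * (v n * gen (chev_f L i) * ?w)"
      by (simp only: const_left_commute mult.assoc)
    moreover have "vev L lam (v n * gen (chev_f L i) * ?w) = vev L lam (const (\<mu>' i) * (v (decr i n) * ?w))"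
      using dual_verma_idealD(3)[OF v[of i, OF that], of ?w]
      by (intro vev_dual_verma_cong) (simp add: left_diff_distrib mult.assoc)
    ultimately show ?thesis by (simp add: vev_scale coeff_uv)
  qed
  have "casimir_gap lam n * coeff n
      = vev L lam (v n * (const (casimir_gap lam n) * left_rec.whittaker n))"
    by (simp only: coeff_uv const_left_commute vev_scale)
  also have "\<dots> = (\<Sum>i\<in>UNIV. vev L lam (v n * (if n i = 0 then 0
      else const (of_nat (symmetrizer L i) * \<mu> i) * (gen (chev_f L i) * left_rec.whittaker (decr i n)))))"
    unfolding left_rec.whittaker_recursion sum_distrib_left vev_sum by simp
  also have "\<dots> = (\<Sum>i\<in>UNIV. if n i = 0 then 0
      else of_nat (symmetrizer L i) * \<mu> i * \<mu>' i * coeff (decr i n))"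
    by (rule sum.cong) (auto simp: summand)
  finally show ?thesis .
qed

section \<open>From the recursion to the Toda equation\<close>

lemma whittaker_function_root_comb: "whittaker_function L lam \<mu> \<mu>' (lam - root_comb L n) = coeff n"
proof -
  have "{m. lam - root_comb L m = lam - root_comb L n} = {n}" by (auto simp: root_comb_inj)
  then show ?thesis by (simp add: whittaker_function_def coeff_def)
qed

lemma whittaker_function_eq_0:
  assumes "\<And>n. \<eta> \<noteq> lam - root_comb L n"
  shows "whittaker_function L lam \<mu> \<mu>' \<eta> = 0"
proof -
  have "{n. lam - root_comb L n = \<eta>} = {}" using assms by auto
  then show ?thesis by (simp add: whittaker_function_def)
qed

text \<open>This is the effect of the potential e^(-(alpha_j|phi)) on coefficients: the one at beta
  - alpha_j moves to beta. For \<open>n j = 0\<close>, independence of the simple roots keeps beta -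
  alpha_j out of Q_+.\<close>

lemma whittaker_function_add_root:
  "whittaker_function L lam \<mu> \<mu>' (lam - root_comb L n + simple_root L j)
    = (if n j = 0 then 0 else coeff (decr j n))"
proof (cases "n j = 0")
  case True
  have "lam - root_comb L n + simple_root L j \<noteq> lam - root_comb L m" for m
  proof
    assume "lam - root_comb L n + simple_root L j = lam - root_comb L m"
    then have "root_comb L n = root_comb L (incr j m)" by (simp add: root_comb_incr algebra_simps)
    then have "n j = incr j m j" by (simp add: root_comb_inj)
    with True show False by simp
  qed
  with True show ?thesis by (simp add: whittaker_function_eq_0)
next
  case False
  then have *: "lam - root_comb L n + simple_root L j = lam - root_comb L (decr j n)"
    using root_comb_incr[of j "decr j n"] by (simp add: incr_decr)
  show ?thesis unfolding * whittaker_function_root_comb using False by simp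
qed

text \<open>Each derivative multiplies by a coordinate of \<eta> with respect to the fundamental
  weights, so the double sum is the bilinear expansion of the form.\<close>

lemma laplacian_eq_form:
  "(\<Sum>i\<in>UNIV. \<Sum>j\<in>UNIV. form L (fund_weight i) (fund_weight j) * partial i (partial j G) \<eta>)
    = form L \<eta> \<eta> * G \<eta>"
proof -
  have \<eta>: "\<eta> = (\<Sum>i\<in>UNIV. \<eta> $ i *s fund_weight i)"
    by (simp add: fund_weight_def basis_expansion)
  have "form L \<eta> \<eta> = (\<Sum>i\<in>UNIV. \<Sum>j\<in>UNIV. \<eta> $ i * (\<eta> $ j * form L (fund_weight i) (fund_weight j)))"
    by (subst \<eta>, subst (2) \<eta>)
      (simp add: form_sum_left form_sum_right form_scale_left form_scale_right sum_distrib_left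
        form_sym[of "fund_weight i" "fund_weight j" for i j])
  then show ?thesis by (simp add: partial_def sum_distrib_left mult_ac)
qed

lemma toda_equation:
  "toda_hamiltonian L (\<lambda>j. of_nat (symmetrizer L j) * \<mu> j * \<mu>' j)
      (modified_whittaker_function L lam \<mu> \<mu>') \<eta>
    = 1/2 * form L (lam + weyl_vector) (lam + weyl_vector)
      * modified_whittaker_function L lam \<mu> \<mu>' \<eta>"
proof -
  let ?W = "whittaker_function L lam \<mu> \<mu>'"
  \<comment> \<open>The prefactor e^(sum of phi_i) is e^((rho|phi)). It shifts the exponents to lam
    + rho - beta, so that the Laplacian yields the square completed in
    \<open>form_shift\<close>.\<close>
  have weyl: "(\<chi> i. 1) = (weyl_vector :: complex ^ 'i)"
    by (simp add: vec_eq_iff weyl_vector_def fund_weight_def sum_component axis_def)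
  have M: "modified_whittaker_function L lam \<mu> \<mu>' \<kappa> = ?W (\<kappa> - weyl_vector)" for \<kappa>
    by (simp add: modified_whittaker_function_def exp_mult_def weyl)
  have H: "toda_hamiltonian L (\<lambda>j. of_nat (symmetrizer L j) * \<mu> j * \<mu>' j)
      (modified_whittaker_function L lam \<mu> \<mu>') \<eta>
    = 1/2 * form L \<eta> \<eta> * ?W (\<eta> - weyl_vector)
      + (\<Sum>j\<in>UNIV. of_nat (symmetrizer L j) * \<mu> j * \<mu>' j * ?W (\<eta> - weyl_vector + simple_root L j))"
    by (simp add: toda_hamiltonian_def laplacian_eq_form M exp_mult_def algebra_simps)
  show ?thesis
  proof (cases "\<exists>n. \<eta> - weyl_vector = lam - root_comb L n")
    case True
    then obtain n where n: "\<eta> - weyl_vector = lam - root_comb L n" by blast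
    then have \<eta>: "\<eta> = lam + weyl_vector - root_comb L n" by (simp add: algebra_simps)
    have "(\<Sum>j\<in>UNIV. of_nat (symmetrizer L j) * \<mu> j * \<mu>' j
        * ?W (\<eta> - weyl_vector + simple_root L j)) = casimir_gap lam n * coeff n"
      unfolding n whittaker_function_add_root coeff_recursion by (rule sum.cong) auto
    moreover have "1/2 * form L \<eta> \<eta>
        = 1/2 * form L (lam + weyl_vector) (lam + weyl_vector) - casimir_gap lam n"
      unfolding \<eta> by (rule form_shift)
    ultimately show ?thesis
      unfolding H unfolding M n whittaker_function_root_comb by (simp only: left_diff_distrib diff_add_cancel)
  next
    \<comment> \<open>Off the set lam + rho - Q_+ both sides vanish: Q_+ is closed under adding
      alpha_j, so the potential cannot bring in a nonzero coefficient.\<close>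
    case False
    then have 0: "?W (\<eta> - weyl_vector) = 0" by (intro whittaker_function_eq_0) auto
    have "?W (\<eta> - weyl_vector + simple_root L j) = 0" for j
    proof (rule whittaker_function_eq_0)
      fix m
      show "\<eta> - weyl_vector + simple_root L j \<noteq> lam - root_comb L m"
      proof
        assume "\<eta> - weyl_vector + simple_root L j = lam - root_comb L m"
        then have "\<eta> - weyl_vector = lam - root_comb L (incr j m)"
          by (simp add: root_comb_incr algebra_simps)
        with False show False by blast
      qed
    qed
    with 0 show ?thesis unfolding H by (simp add: M)
  qed
qed

end

theorem theorem3p12:
  fixes L :: "('g::ab_group_add, 'i::finite) chevalley_data"
    and lam :: "complex ^ 'i"
    and \<mu> \<mu>' :: "'i \<Rightarrow> complex"
  assumes "simple_lie_algebra L"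
    and "generic L lam"
    and "\<forall>i. \<mu> i \<noteq> 0" and "\<forall>i. \<mu>' i \<noteq> 0"
  shows "toda_hamiltonian L (\<lambda>j. of_nat (symmetrizer L j) * \<mu> j * \<mu>' j)
           (modified_whittaker_function L lam \<mu> \<mu>')
       = (\<lambda>\<eta>. (1/2 * form L (lam + weyl_vector) (lam + weyl_vector))
               * modified_whittaker_function L lam \<mu> \<mu>' \<eta>)"
proof -
  interpret simple_lie_algebra L by fact
  interpret whittaker_pair L lam \<mu> \<mu>' by unfold_locales fact
  show ?thesis by (rule ext) (rule toda_equation)
qed

end
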